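(* Let $(\overline{\widehat{K}}(X)|K,v)$ be an extension of valued fields, where $\widehat{K}$ is the completion of $(K,v)$. Assume that $(\widehat{K}(X)|\widehat{K},v)$ is valuation transcendental such that $v\widehat{K}$ is cofinal in $v\widehat{K}(X)$. Then $(\widehat{K}(X)|\widehat{K},v)$ is induced by the valuation transcendental extension $(K(X)|K,v)$ (in particular, $(K(X)|K,v)$ is valuation transcendental). In this case, one can choose a minimal pair of definition $(a,\gamma)$ for $v$ over $K$ such that $a\in K^{\mathrm{sep}}$. Further, $(a,\gamma)$ is also a minimal pair of definition for $v$ over $\widehat{K}$, $[K(a):K]=[\widehat{K}(a):\widehat{K}]$, and $(\widehat{K}(X)|K(X),v)$ is immediate.
   Context: Valuations are Krull valuations written additively; $vL$, $Lv$ denote value group and residue field. An extension $(L|K,v)$ is immediate if $vL=vK$ and $Lv=Kv$. $K^{\mathrm{sep}}$ is the separable-algebraic closure of $K$. $(K,v)$ is dense in $(L,v)$ if for every $a\in L$, $\gamma\in vL$ there is $b\in K$ with $v(a-b)>\gamma$; the completion $(\widehat{K},v)$ is the maximal extension in which $(K,v)$ is dense. "An extension of valued fields $(\overline{\widehat{K}}(X)|K,v)$" means a valuation $v$ on $\overline{\widehat{K}}(X)$ ($\overline{\widehat{K}}\supseteq\overline{K}$ the algebraic closure of $\widehat{K}$) whose restriction to $\widehat{K}$ is the valuation of the completion; all subfields carry the restricted valuation. $(F(X)|F,v)$ is value transcendental if $\dim_{\mathbb{Q}}\big((vF(X)/vF)\otimes\mathbb{Q}\big)=1$, residue transcendental if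 $\mathrm{trdeg}[F(X)v:Fv]=1$, and valuation transcendental if it is one of these. For $a\in\overline{F}$ and $\gamma$ in an ordered abelian group containing $v\overline{F}$, $v_{a,\gamma}$ is the valuation on $\overline{F}(X)$ with $v_{a,\gamma}\big(\sum C_i(X-a)^i\big)=\min_i\{vC_i+i\gamma\}$. A pair $(a,\gamma)\in\overline{F}\times v\overline{F}(X)$ is a pair of definition for $v$ over $F$ if $v=v_{a,\gamma}$ on $\overline{F}(X)$; it is a minimal pair of definition for $v$ over $F$ if moreover $[F(a):F]\le[F(b):F]$ for all $b\in\overline{F}$ with $v(a-b)\ge\gamma$. When $(K(X)|K,v)$ is valuation transcendental, "$(\widehat{K}(X)|\widehat{K},v)$ is induced by $(K(X)|K,v)$" means: for a (equivalently any) pair of definition $(a,\gamma)$ for $v|_{\overline{K}(X)}$ over $K$, the restriction of $v$ to $\widehat{K}(X)$ coincides, up to equivalence, with the restriction to $\widehat{K}(X)$ of the valuation $v_{a,\gamma}$ on $\overline{\widehat{K}}(X)$ formed from $v|_{\overline{\widehat{K}}}$. *)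

theory Defs
  imports
    "HOL-Algebra.Algebraic_Closure_Type"
    "HOL-Algebra.Generated_Fields"
    "HOL-Algebra.Free_Abelian_Groups"
    "HOL-Computational_Algebra.Fraction_Field"
    "HOL-Library.Extended"
begin

section \<open>Krull valuations\<close>

text \<open>
  Valuations are written additively and take their values in \<^typ>\<open>'g extended\<close>, where
  \<^term>\<open>Pinf\<close> is the value of zero and \<^term>\<open>Minf\<close> is never attained. All fields below are subfields
  of one field and carry the restriction of one valuation \<open>v\<close>, so a valued field is given by
  its underlying set.
\<close>

definition valuation ::
    "('a, 'b) ring_scheme \<Rightarrow> ('a \<Rightarrow> 'g::linordered_ab_group_add extended) \<Rightarrow> bool" where
  "valuation R v \<longleftrightarrow>
     (\<forall>x\<in>carrier R. v x \<noteq> Minf \<and> (v x = Pinf \<longleftrightarrow> x = \<zero>\<^bsub>R\<^esub>)) \<and>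
     (\<forall>x\<in>carrier R. \<forall>y\<in>carrier R. v (x \<otimes>\<^bsub>R\<^esub> y) = v x + v y) \<and>
     (\<forall>x\<in>carrier R. \<forall>y\<in>carrier R. min (v x) (v y) \<le> v (x \<oplus>\<^bsub>R\<^esub> y))"

definition value_group :: "('a \<Rightarrow> 'g extended) \<Rightarrow> 'a set \<Rightarrow> 'g set" where
  "value_group v E = {\<gamma>. \<exists>x\<in>E. v x = Fin \<gamma>}"

definition valuation_ring ::
    "('a, 'b) ring_scheme \<Rightarrow> ('a \<Rightarrow> 'g::linordered_ab_group_add extended) \<Rightarrow> ('a, 'b) ring_scheme"
  where "valuation_ring R v = R\<lparr>carrier := {x \<in> carrier R. 0 \<le> v x}\<rparr>"

definition valuation_ideal ::
    "('a, 'b) ring_scheme \<Rightarrow> ('a \<Rightarrow> 'g::linordered_ab_group_add extended) \<Rightarrow> 'a set"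
  where "valuation_ideal R v = {x \<in> carrier R. 0 < v x}"

definition residue_class_ring ::
    "('a, 'b) ring_scheme \<Rightarrow> ('a \<Rightarrow> 'g::linordered_ab_group_add extended) \<Rightarrow> 'a set ring"
  where "residue_class_ring R v = valuation_ring R v Quot valuation_ideal R v"

text \<open>
  The residue field of a subfield \<open>E\<close> of \<open>R\<close>, as a subfield of the residue field of \<open>R\<close>: it
  consists of the residue classes of the elements of the valuation ring of \<open>E\<close>.
\<close>
definition residue_field ::
    "('a, 'b) ring_scheme \<Rightarrow> ('a \<Rightarrow> 'g::linordered_ab_group_add extended) \<Rightarrow> 'a set \<Rightarrow> 'a set set"
  where "residue_field R v E =
    (\<lambda>x. valuation_ideal R v +>\<^bsub>valuation_ring R v\<^esub> x) ` {x \<in> E. 0 \<le> v x}"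

definition immediate_extension ::
    "('a, 'b) ring_scheme \<Rightarrow> ('a \<Rightarrow> 'g::linordered_ab_group_add extended) \<Rightarrow> 'a set \<Rightarrow> 'a set \<Rightarrow> bool"
  where "immediate_extension R v E F \<longleftrightarrow>
    value_group v E = value_group v F \<and> residue_field R v E = residue_field R v F"

text \<open>Two valuations are equivalent on a field if they have the same valuation ring there.\<close>
definition equivalent_valuations_on ::
    "'a set \<Rightarrow> ('a \<Rightarrow> 'g::linordered_ab_group_add extended) \<Rightarrow> ('a \<Rightarrow> 'g extended) \<Rightarrow> bool"
  where "equivalent_valuations_on E v w \<longleftrightarrow> (\<forall>x\<in>E. 0 \<le> v x \<longleftrightarrow> 0 \<le> w x)"

definition dense_subfield ::
    "('a, 'b) ring_scheme \<Rightarrow> ('a \<Rightarrow> 'g::linordered_ab_group_add extended) \<Rightarrow> 'a set \<Rightarrow> 'a set \<Rightarrow> bool"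
  where "dense_subfield R v K L \<longleftrightarrow>
    (\<forall>a\<in>L. \<forall>\<gamma>\<in>value_group v L. \<exists>b\<in>K. Fin \<gamma> < v (a \<ominus>\<^bsub>R\<^esub> b))"

text \<open>
  The completion of \<open>K\<close> is the maximal extension in which \<open>K\<close> is dense: every extension \<open>L\<close>
  of the valued field \<open>K'\<close> (with embedding \<open>h\<close>) in which \<open>K\<close> is still dense is equal to \<open>K'\<close>.
  Taking the carrier of \<open>L\<close> in the type \<^typ>\<open>'g \<Rightarrow> 'a\<close> and its values in \<^typ>\<open>'g\<close> is
  no restriction: density forces \<open>L\<close> to have the same value group as \<open>K\<close>, and an
  element \<open>a\<close> of \<open>L\<close> is determined by any choice of elements \<open>b \<gamma>\<close> of \<open>K\<close> with
  \<open>v (a - b \<gamma>) > \<gamma>\<close>, where \<open>\<gamma>\<close> ranges over that value group.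
\<close>
definition is_completion ::
    "('a, 'b) ring_scheme \<Rightarrow> ('a \<Rightarrow> 'g::linordered_ab_group_add extended) \<Rightarrow> 'a set \<Rightarrow> 'a set \<Rightarrow> bool"
  where "is_completion R v K K' \<longleftrightarrow>
    K \<subseteq> K' \<and> dense_subfield R v K K' \<and>
    (\<forall>(L :: ('g \<Rightarrow> 'a) ring) (w :: ('g \<Rightarrow> 'a) \<Rightarrow> 'g extended) h.
       field L \<and> valuation L w \<and>
       h \<in> ring_hom (R\<lparr>carrier := K'\<rparr>) L \<and> (\<forall>x\<in>K'. w (h x) = v x) \<and>
       dense_subfield L w (h ` K) (carrier L)
       \<longrightarrow> h ` K' = carrier L)"


section \<open>Dimension of the tensor product of an abelian group with the rationals\<close>

text \<open>
  For an abelian group \<open>M\<close> (in the multiplicative notation of HOL-Algebra), the tensor product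
  with the rationals over the integers is the free abelian group on the pairs \<open>(x, q)\<close>, modulo
  the bilinearity relations.
\<close>
definition tensor_rat_free :: "('m, 'z) monoid_scheme \<Rightarrow> ('m \<times> rat \<Rightarrow>\<^sub>0 int) monoid" where
  "tensor_rat_free M = free_Abelian_group (carrier M \<times> UNIV)"

definition tensor_rat_rel :: "('m, 'z) monoid_scheme \<Rightarrow> ('m \<times> rat \<Rightarrow>\<^sub>0 int) set" where
  "tensor_rat_rel M = generate (tensor_rat_free M)
     ({frag_of (x \<otimes>\<^bsub>M\<^esub> y, q) - frag_of (x, q) - frag_of (y, q) | x y q.
         x \<in> carrier M \<and> y \<in> carrier M} \<union>
      {frag_of (x, p + q) - frag_of (x, p) - frag_of (x, q) | x p q. x \<in> carrier M})"

definition tensor_rat :: "('m, 'z) monoid_scheme \<Rightarrow> ('m \<times> rat \<Rightarrow>\<^sub>0 int) set monoid" where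
  "tensor_rat M = tensor_rat_free M Mod tensor_rat_rel M"

text \<open>Scalar multiplication, induced by \<open>r \<cdot> (x \<otimes> q) = x \<otimes> (r q)\<close>.\<close>
definition tensor_rat_smult ::
    "('m, 'z) monoid_scheme \<Rightarrow> rat \<Rightarrow> ('m \<times> rat \<Rightarrow>\<^sub>0 int) set \<Rightarrow> ('m \<times> rat \<Rightarrow>\<^sub>0 int) set" where
  "tensor_rat_smult M r Y =
     (\<Union>z\<in>Y. tensor_rat_rel M #>\<^bsub>tensor_rat_free M\<^esub>
               frag_extend (\<lambda>(x, q). frag_of (x, r * q)) z)"

definition tensor_rat_basis ::
    "('m, 'z) monoid_scheme \<Rightarrow> ('m \<times> rat \<Rightarrow>\<^sub>0 int) set set \<Rightarrow> bool" where
  "tensor_rat_basis M B \<longleftrightarrow>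
     finite B \<and> B \<subseteq> carrier (tensor_rat M) \<and>
     (\<forall>y\<in>carrier (tensor_rat M).
        \<exists>!c. c \<in> extensional B \<and>
             y = finprod (tensor_rat M) (\<lambda>b. tensor_rat_smult M (c b) b) B)"

definition has_tensor_rat_dim :: "('m, 'z) monoid_scheme \<Rightarrow> nat \<Rightarrow> bool" where
  "has_tensor_rat_dim M n \<longleftrightarrow> (\<exists>B. tensor_rat_basis M B \<and> card B = n)"

definition quotient_group :: "'g::ab_group_add set \<Rightarrow> 'g set \<Rightarrow> 'g set monoid" where
  "quotient_group A B = \<lparr>carrier = A, monoid.mult = (+), one = 0\<rparr> Mod B"


section \<open>Transcendence degree, extension degree and separable closure\<close>

text \<open>A family is algebraically independent iff each member is transcendental over the others.\<close>
definition transcendence_basis ::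
    "('a, 'b) ring_scheme \<Rightarrow> 'a set \<Rightarrow> 'a set \<Rightarrow> 'a set \<Rightarrow> bool" where
  "transcendence_basis R F E B \<longleftrightarrow>
     B \<subseteq> E \<and>
     (\<forall>t\<in>B. ring.transcendental R (generate_field R (F \<union> (B - {t}))) t) \<and>
     (\<forall>x\<in>E. \<not> ring.transcendental R (generate_field R (F \<union> B)) x)"

definition has_trdeg :: "('a, 'b) ring_scheme \<Rightarrow> 'a set \<Rightarrow> 'a set \<Rightarrow> nat \<Rightarrow> bool" where
  "has_trdeg R F E n \<longleftrightarrow> (\<exists>B. finite B \<and> card B = n \<and> transcendence_basis R F E B)"

abbreviation type_field :: "'a::field ring" where
  "type_field \<equiv> ring_of_type_algebra"

text \<open>
  In the following, the type \<^typ>\<open>'c\<close> is an algebraically closed field containing all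
  algebraic extensions under consideration.
\<close>
definition algebraic_closure_of :: "'c::field set \<Rightarrow> 'c set" where
  "algebraic_closure_of F = {a. \<not> ring.transcendental type_field F a}"

definition separable_closure_of :: "'c::field set \<Rightarrow> 'c set" where
  "separable_closure_of F =
     {a \<in> algebraic_closure_of F.
        \<forall>x. ring.alg_mult type_field (ring.Irr type_field F a) x \<le> 1}"

definition simple_ext_degree :: "'c::field set \<Rightarrow> 'c \<Rightarrow> nat" where
  "simple_ext_degree F a = ring.dim type_field F (generate_field type_field (F \<union> {a}))"


section \<open>Valuations on a rational function field\<close>

definition rf_const :: "'c::field \<Rightarrow> 'c poly fract" where
  "rf_const c = Fract [:c:] 1"

definition rf_X :: "'c::field poly fract" where
  "rf_X = Fract [:0, 1:] 1"

definition ratfun :: "'c::field set \<Rightarrow> 'c poly fract set" where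
  "ratfun F = generate_field type_field (rf_const ` F \<union> {rf_X})"

definition value_transcendental ::
    "('c::field poly fract \<Rightarrow> 'g::linordered_ab_group_add extended) \<Rightarrow> 'c set \<Rightarrow> bool" where
  "value_transcendental v F \<longleftrightarrow>
     has_tensor_rat_dim (quotient_group (value_group v (ratfun F)) (value_group v (rf_const ` F))) 1"

definition residue_transcendental ::
    "('c::field poly fract \<Rightarrow> 'g::linordered_ab_group_add extended) \<Rightarrow> 'c set \<Rightarrow> bool" where
  "residue_transcendental v F \<longleftrightarrow>
     has_trdeg (residue_class_ring type_field v)
       (residue_field type_field v (rf_const ` F)) (residue_field type_field v (ratfun F)) 1"

definition valuation_transcendental ::
    "('c::field poly fract \<Rightarrow> 'g::linordered_ab_group_add extended) \<Rightarrow> 'c set \<Rightarrow> bool" where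
  "valuation_transcendental v F \<longleftrightarrow> value_transcendental v F \<or> residue_transcendental v F"

text \<open>
  The valuation \<open>v\<^sub>a\<^sub>,\<^sub>\<gamma>\<close> formed from the valuation \<open>u\<close> of the field of constants. A sum
  \<open>\<gamma> + \<dots> + \<gamma>\<close> of length \<open>i\<close> is written \<^term>\<open>\<Sum>j<i. \<gamma>\<close>.
\<close>
definition monomial_valuation ::
    "('c::field \<Rightarrow> 'g::linordered_ab_group_add extended) \<Rightarrow> 'c \<Rightarrow> 'g \<Rightarrow> 'c poly fract \<Rightarrow> 'g extended"
  where "monomial_valuation u a \<gamma> =
    (THE w. valuation type_field w \<and>
       (\<forall>(n::nat) C. w (\<Sum>i\<le>n. rf_const (C i) * (rf_X - rf_const a) ^ i) =
                     Min ((\<lambda>i. u (C i) + Fin (\<Sum>j<i. \<gamma>)) ` {..n})))"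

text \<open>
  For \<open>a\<close> algebraic over \<open>F\<close>, the valuation \<open>v\<^sub>a\<^sub>,\<^sub>\<gamma>\<close> on the rational functions over the
  algebraic closure of \<open>F\<close> is the restriction of the one on all rational functions.
\<close>
definition pair_of_definition ::
    "('c::field poly fract \<Rightarrow> 'g::linordered_ab_group_add extended) \<Rightarrow> 'c set \<Rightarrow> 'c \<Rightarrow> 'g \<Rightarrow> bool"
  where "pair_of_definition v F a \<gamma> \<longleftrightarrow>
    a \<in> algebraic_closure_of F \<and>
    \<gamma> \<in> value_group v (ratfun (algebraic_closure_of F)) \<and>
    (\<forall>f\<in>ratfun (algebraic_closure_of F). v f = monomial_valuation (v \<circ> rf_const) a \<gamma> f)"

definition minimal_pair_of_definition ::
    "('c::field poly fract \<Rightarrow> 'g::linordered_ab_group_add extended) \<Rightarrow> 'c set \<Rightarrow> 'c \<Rightarrow> 'g \<Rightarrow> bool"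
  where "minimal_pair_of_definition v F a \<gamma> \<longleftrightarrow>
    pair_of_definition v F a \<gamma> \<and>
    (\<forall>b\<in>algebraic_closure_of F. Fin \<gamma> \<le> v (rf_const (a - b)) \<longrightarrow>
       simple_ext_degree F a \<le> simple_ext_degree F b)"

definition induced_by ::
    "('c::field poly fract \<Rightarrow> 'g::linordered_ab_group_add extended) \<Rightarrow> 'c set \<Rightarrow> 'c set \<Rightarrow> bool"
  where "induced_by v K' K \<longleftrightarrow>
    valuation_transcendental v K \<and>
    (\<exists>a \<gamma>. pair_of_definition v K a \<gamma> \<and>
       equivalent_valuations_on (ratfun K') v (monomial_valuation (v \<circ> rf_const) a \<gamma>))"

end

theory Submission
  imports Defs
begin

text \<open>
  If the values of the linear polynomials \<open>X - a\<close> had no maximum, every rational function would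
  be close to a constant, so that \<open>(Khat(X)|Khat, v)\<close> would have a torsion value group quotient
  and an algebraic residue field extension. Hence a maximum \<open>\<gamma> = v (X - a)\<close> exists, and
  since polynomials split into linear factors, \<open>v\<close> is the Gauss valuation
  \<open>v\<^sub>a\<^sub>,\<^sub>\<gamma>\<close>; the pairs of definition are exactly the pairs of this
  form. By cofinality \<open>\<gamma>\<close> is bounded by a value of \<open>Khat\<close>, so by
  continuity of roots \<open>a\<close> may be moved, without raising its degree, to a root of a polynomial
  over \<open>K\<close>, which a further small perturbation makes separable. Cofinality also makes
  \<open>K(X)\<close> dense in \<open>Khat(X)\<close>, so this extension is immediate, and valuation
  transcendence only depends on value groups and residue fields.
\<close>


section \<open>Krull valuations on a field\<close>

text \<open>The maximum \<gamma> is the value of X - a with a merely algebraic over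
  \<open>Khat\<close>, so cofinality of v(Khat) in v(Khat(X)) does not bound it at once. A
  polynomial f over \<open>Khat\<close> with f(a) = 0 mediates: v(f) is a value of Khat(X), and it
  equals v(c) + i \<gamma> for a coefficient c of f(X + a) with i > 0, the constant coefficient
  being f(a) = 0. Values of algebraic constants are bounded because a positive multiple of each lies
  in v(Khat).

  Two obstacles remain. A separable perturbation needs elements of K of large value, so a trivially
  valued \<open>Khat\<close> is a case of its own: there cofinality forces \<gamma> \<le> 0 \<le>
  v(X), and a = 0 serves. Moreover, a pair of definition over K speaks only of rational functions
  over the algebraic closure of K; maximality of \<gamma> among all constants is recovered by
  approximating them by elements of that closure.\<close>

lemma type_field_simps [simp]:
  "carrier type_field = UNIV"
  "x \<otimes>\<^bsub>type_field\<^esub> y = x * y" "x \<oplus>\<^bsub>type_field\<^esub> y = x + y"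
  "\<one>\<^bsub>type_field\<^esub> = 1" "\<zero>\<^bsub>type_field\<^esub> = 0"
  by (simp_all add: ring_of_type_algebra_def)

lemma field_type_field: "Ring.field (type_field :: 'a::field ring)"
  by (rule field_from_type_algebra)

lemma ring_type_field: "Ring.ring (type_field :: 'a::field ring)"
  by (rule ring_from_type_algebra)

lemma type_field_a_inv [simp]: "\<ominus>\<^bsub>type_field\<^esub> x = - (x :: 'a::field)"
proof -
  interpret R: Ring.field "type_field :: 'a ring" by (rule field_type_field)
  show ?thesis by (rule R.minus_equality) auto
qed

lemma type_field_minus [simp]: "x \<ominus>\<^bsub>type_field\<^esub> y = x - (y :: 'a::field)"
  by (simp add: a_minus_def)

lemma type_field_m_inv [simp]: "x \<noteq> 0 \<Longrightarrow> inv\<^bsub>type_field\<^esub> x = inverse (x :: 'a::field)"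
proof -
  interpret R: Ring.field "type_field :: 'a ring" by (rule field_type_field)
  assume "x \<noteq> 0"
  thus ?thesis by (intro R.inv_char) auto
qed

lemma type_field_nat_pow [simp]: "x [^]\<^bsub>type_field\<^esub> (n::nat) = (x :: 'a::field) ^ n"
  by (induction n) (auto simp: nat_pow_def mult.commute)

locale krull_valuation =
  fixes v :: "'f::field \<Rightarrow> 'g::linordered_ab_group_add extended"
  assumes not_Minf: "v x \<noteq> Minf"
    and eq_Pinf_iff [simp]: "v x = Pinf \<longleftrightarrow> x = 0"
    and v_mult: "v (x * y) = v x + v y"
    and v_add: "min (v x) (v y) \<le> v (x + y)"

lemma valuation_type_field_iff: "valuation type_field v \<longleftrightarrow> krull_valuation v"
  unfolding valuation_def krull_valuation_def by auto

context krull_valuation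
begin

lemma v_zero [simp]: "v 0 = Pinf"
  by simp

lemma v_finite:
  assumes "x \<noteq> 0"
  obtains a where "v x = Fin a"
  using assms not_Minf[of x] by (cases "v x") auto

lemma v_one [simp]: "v 1 = Fin 0"
proof -
  obtain a where a: "v 1 = Fin a" by (rule v_finite) auto
  have "v (1 * 1) = v 1 + v 1" by (rule v_mult)
  with a show ?thesis by simp
qed

lemma v_minus_one [simp]: "v (- 1) = Fin 0"
proof -
  obtain a where a: "v (- 1) = Fin a" by (rule v_finite) auto
  have "v (- 1 * - 1) = v (- 1) + v (- 1)" by (rule v_mult)
  with a show ?thesis by simp
qed

lemma v_minus [simp]: "v (- x) = v x"
  using v_mult[of "- 1" x] not_Minf[of x] by (cases "v x") auto

lemma v_diff_commute: "v (x - y) = v (y - x)"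
  using v_minus[of "x - y"] by simp

lemma le_v_add: "c \<le> v x \<Longrightarrow> c \<le> v y \<Longrightarrow> c \<le> v (x + y)"
  using v_add[of x y] by (auto simp: min_def split: if_splits)

lemma less_v_add: "c < v x \<Longrightarrow> c < v y \<Longrightarrow> c < v (x + y)"
  using v_add[of x y] by (auto simp: min_def split: if_splits)

lemma less_v_diff: "c < v x \<Longrightarrow> c < v y \<Longrightarrow> c < v (x - y)"
  using less_v_add[of c x "- y"] by simp

lemma le_v_sum: "(\<And>i. i \<in> A \<Longrightarrow> c \<le> v (f i)) \<Longrightarrow> c \<le> v (sum f A)"
  by (induction A rule: infinite_finite_induct) (auto intro!: le_v_add)

lemma less_v_sum: "(\<And>i. i \<in> A \<Longrightarrow> Fin c < v (f i)) \<Longrightarrow> Fin c < v (sum f A)"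
  by (induction A rule: infinite_finite_induct) (auto intro!: less_v_add)

lemma v_add_eq_left:
  assumes "v x < v y"
  shows "v (x + y) = v x"
proof (rule antisym)
  show "v x \<le> v (x + y)"
    using assms by (intro le_v_add) auto
  show "v (x + y) \<le> v x"
  proof (rule ccontr)
    assume "\<not> ?thesis"
    hence "v x < v (x + y - y)"
      using assms by (intro less_v_diff) auto
    thus False by simp
  qed
qed

lemma v_inverse:
  assumes "v x = Fin a"
  shows "v (inverse x) = Fin (- a)"
proof -
  have x: "x \<noteq> 0" using assms by auto
  then obtain b where b: "v (inverse x) = Fin b" by (meson v_finite nonzero_imp_inverse_nonzero)
  have "v (x * inverse x) = v x + v (inverse x)" by (rule v_mult)
  with x assms b have "a + b = 0" by simp
  with b show ?thesis by (simp add: eq_neg_iff_add_eq_0 add.commute)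
qed

lemma v_divide:
  assumes "v x = Fin a" "v y = Fin b"
  shows "v (x / y) = Fin (a - b)"
  using v_inverse[OF assms(2)] assms(1) by (simp add: divide_inverse v_mult)

lemma v_power: "v x = Fin a \<Longrightarrow> v (x ^ n) = Fin (\<Sum>j<n. a)"
  by (induction n) (simp_all add: v_mult add.commute)

lemma Fin_add_less_v_mult:
  assumes "Fin a < v x" "Fin b \<le> v y"
  shows "Fin (a + b) < v (x * y)"
proof (cases "v x"; cases "v y")
  fix c d assume "v x = Fin c" "v y = Fin d"
  with assms show ?thesis by (simp add: v_mult add_less_le_mono)
qed (use assms in \<open>auto simp: v_mult\<close>)

lemma Fin_add_le_v_mult:
  assumes "Fin a \<le> v x" "Fin b \<le> v y"
  shows "Fin (a + b) \<le> v (x * y)"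
proof (cases "v x"; cases "v y")
  fix c d assume "v x = Fin c" "v y = Fin d"
  with assms show ?thesis by (simp add: v_mult add_mono)
qed (use assms in \<open>auto simp: v_mult\<close>)

text \<open>The relative error of y as an approximation to x has positive value, that is, y / x is a
  1-unit. The strict inequality excludes x = 0. The relation respects products and inverses, and
  this is why it is preferred to a bound on v(x - y).\<close>

definition near :: "'f \<Rightarrow> 'f \<Rightarrow> bool" where
  "near x y \<longleftrightarrow> v x < v (x - y)"

lemma near_refl: "x \<noteq> 0 \<Longrightarrow> near x x"
  using not_Minf[of x] by (cases "v x") (auto simp: near_def)

lemma near_v_eq: "near x y \<Longrightarrow> v y = v x"
  using v_add_eq_left[of x "y - x"] unfolding near_def by (simp add: v_diff_commute)

lemma near_nonzero: "near x y \<Longrightarrow> x \<noteq> 0 \<and> y \<noteq> 0"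
  using near_v_eq[of x y] by (metis eq_Pinf_iff less_extended_simps(4) near_def)

lemma near_mult:
  assumes "near x x'" "near y y'"
  shows "near (x * y) (x' * y')"
proof -
  from near_nonzero assms have nz: "x \<noteq> 0" "y \<noteq> 0" by auto
  obtain a where a: "v x = Fin a" using nz v_finite by blast
  obtain b where b: "v y = Fin b" using nz v_finite by blast
  have b': "v y' = Fin b" using near_v_eq[OF assms(2)] b by simp
  \<comment> \<open>The two terms come from x y - x' y' = (y - y') x + (x - x') y'.\<close>
  have "Fin (b + a) < v ((y - y') * x)"
    using assms a b by (intro Fin_add_less_v_mult) (auto simp: near_def)
  moreover have "Fin (a + b) < v ((x - x') * y')"
    using assms a b' by (intro Fin_add_less_v_mult) (auto simp: near_def)
  ultimately have "Fin (a + b) < v ((y - y') * x + (x - x') * y')"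
    by (intro less_v_add) (auto simp: add.commute)
  thus ?thesis by (simp add: near_def v_mult a b algebra_simps)
qed

lemma near_inverse:
  assumes "near x y"
  shows "near (inverse x) (inverse y)"
proof -
  from near_nonzero assms have nz: "x \<noteq> 0" "y \<noteq> 0" by auto
  obtain a where a: "v x = Fin a" using nz v_finite by blast
  have b: "v y = Fin a" using near_v_eq[OF assms] a by simp
  \<comment> \<open>The difference of the inverses is (x - y) / (x y) up to sign, and both inverses
    have value -a; the sum a - a - a is the value of \<open>inverse x\<close>.\<close>
  have "Fin (a + (- a + - a)) < v ((x - y) * (inverse x * inverse y))"
    using assms a v_inverse[OF a] v_inverse[OF b]
    by (intro Fin_add_less_v_mult) (auto simp: near_def v_mult)
  also have "(x - y) * (inverse x * inverse y) = - (inverse x - inverse y)"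
    using nz by (simp add: field_simps)
  also have "v \<dots> = v (inverse x - inverse y)"
    by (rule v_minus)
  finally show ?thesis by (simp add: near_def v_inverse[OF a])
qed

lemma near_divide: "near x x' \<Longrightarrow> near y y' \<Longrightarrow> near (x / y) (x' / y')"
  by (simp add: divide_inverse near_mult near_inverse)

section \<open>Valuation ring, its maximal ideal and residue classes\<close>

lemma ring_valuation_ring: "Ring.ring (valuation_ring type_field v)"
proof -
  have "subring {x. 0 \<le> v x} type_field"
    using Fin_add_le_v_mult[of 0 _ 0]
    by (intro ring.subringI ring_type_field) (auto simp: zero_extended_def le_v_add)
  thus ?thesis
    unfolding valuation_ring_def
    using ring.subring_is_ring[OF ring_type_field] by simp
qed

lemma valuation_ring_simps:
  "carrier (valuation_ring type_field v) = {x. 0 \<le> v x}"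
  "x \<otimes>\<^bsub>valuation_ring type_field v\<^esub> y = x * y" "x \<oplus>\<^bsub>valuation_ring type_field v\<^esub> y = x + y"
  "\<one>\<^bsub>valuation_ring type_field v\<^esub> = 1" "\<zero>\<^bsub>valuation_ring type_field v\<^esub> = 0"
  by (auto simp: valuation_ring_def)

lemma ideal_valuation_ideal: "ideal (valuation_ideal type_field v) (valuation_ring type_field v)"
proof (rule idealI[OF ring_valuation_ring])
  interpret R: Ring.ring "valuation_ring type_field v" by (rule ring_valuation_ring)
  have "\<ominus>\<^bsub>valuation_ring type_field v\<^esub> x = - x" if "0 \<le> v x" for x
    using that by (intro R.minus_equality) (auto simp: valuation_ring_simps)
  then show "subgroup (valuation_ideal type_field v) (add_monoid (valuation_ring type_field v))"
    by (intro R.add.subgroupI)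
      (auto simp: valuation_ring_simps valuation_ideal_def less_v_add zero_extended_def
        a_inv_def[symmetric] intro: exI[of _ 0])
next
  fix a x assume "a \<in> valuation_ideal type_field v" "x \<in> carrier (valuation_ring type_field v)"
  then show "x \<otimes>\<^bsub>valuation_ring type_field v\<^esub> a \<in> valuation_ideal type_field v"
    "a \<otimes>\<^bsub>valuation_ring type_field v\<^esub> x \<in> valuation_ideal type_field v"
    using Fin_add_less_v_mult[of 0 a 0 x]
    by (auto simp: valuation_ring_simps valuation_ideal_def zero_extended_def mult.commute)
qed

abbreviation res :: "'f \<Rightarrow> 'f set" where
  "res x \<equiv> valuation_ideal type_field v +>\<^bsub>valuation_ring type_field v\<^esub> x"

lemma res_eq_iff:
  assumes "0 \<le> v x" "0 \<le> v y"
  shows "res x = res y \<longleftrightarrow> 0 < v (x - y)"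
proof -
  interpret I: ideal "valuation_ideal type_field v" "valuation_ring type_field v"
    by (rule ideal_valuation_ideal)
  have "\<ominus>\<^bsub>valuation_ring type_field v\<^esub> y = - y"
    using assms by (intro I.minus_equality) (auto simp: valuation_ring_simps)
  then show ?thesis
    using assms I.quotient_eq_iff_same_a_r_cos[OF ideal_valuation_ideal, of x y]
    by (simp add: valuation_ring_simps a_minus_def valuation_ideal_def)
qed

text \<open>Near elements have equal values, and if v(x) \<ge> 0 then v(x - y) > v(x) \<ge> 0 makes
  their residues equal. Zero is near nothing and is treated apart.\<close>

lemma immediate_extension_near:
  assumes "E \<subseteq> F" and near: "\<And>x. x \<in> F \<Longrightarrow> x \<noteq> 0 \<Longrightarrow> \<exists>y\<in>E. near x y" and "0 \<in> E"
  shows "value_group v E = value_group v F" "residue_field type_field v E = residue_field type_field v F"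
proof -
  show "value_group v E = value_group v F"
  proof
    show "value_group v E \<subseteq> value_group v F"
      using assms(1) by (auto simp: value_group_def)
    show "value_group v F \<subseteq> value_group v E"
    proof
      fix \<gamma> assume "\<gamma> \<in> value_group v F"
      then obtain x where x: "x \<in> F" "v x = Fin \<gamma>" by (auto simp: value_group_def)
      moreover from x have "x \<noteq> 0" by auto
      ultimately obtain y where "y \<in> E" "near x y" using near[of x] by blast
      thus "\<gamma> \<in> value_group v E"
        using near_v_eq[of x y] x by (auto simp: value_group_def)
    qed
  qed
  have "\<exists>y\<in>E. 0 \<le> v y \<and> res x = res y" if "x \<in> F" "0 \<le> v x" for x
  proof (cases "x = 0")
    case True thus ?thesis using assms(3) by (auto intro!: bexI[of _ 0])
  next
    case False
    with near that obtain y where y: "y \<in> E" "near x y" by blast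
    hence "0 \<le> v y" using near_v_eq[of x y] that by simp
    moreover have "0 < v (x - y)"
      using y that unfolding near_def by simp
    ultimately show ?thesis
      using y that res_eq_iff[of x y] by auto
  qed
  thus "residue_field type_field v E = residue_field type_field v F"
    using assms(1) unfolding residue_field_def by (auto simp: image_iff) blast+
qed

end


section \<open>Gauss valuations\<close>

text \<open>The value of p / q has to be w(p) - w(q). It is encoded as the e with w(p) = e + w(q)
  for every representation of the fraction, which avoids a subtraction on \<open>extended\<close>;
  cross multiplication shows that one representation determines e for all others.\<close>

lemma exists_valuation_on_fract:
  fixes w :: "'r::idom \<Rightarrow> 'g::linordered_ab_group_add extended"
  assumes w_Minf: "\<And>x. w x \<noteq> Minf" and w_Pinf: "\<And>x. w x = Pinf \<longleftrightarrow> x = 0"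
    and w_mult: "\<And>x y. w (x * y) = w x + w y"
    and w_add: "\<And>x y. min (w x) (w y) \<le> w (x + y)"
  obtains v where "krull_valuation v" "\<And>x. v (to_fract x) = w x"
proof -
  have ex: "\<exists>e. \<forall>p q. q \<noteq> 0 \<longrightarrow> f = Fract p q \<longrightarrow> w p = e + w q" for f :: "'r fract"
  proof -
    obtain p0 q0 where f: "f = Fract p0 q0" "q0 \<noteq> 0" by (cases f)
    obtain b where b: "w q0 = Fin b" using w_Minf[of q0] w_Pinf[of q0] f(2) by (cases "w q0") auto
    have "w p = (w p0 + Fin (- b)) + w q" if q: "q \<noteq> 0" "f = Fract p q" for p q
    proof -
      have "p0 * q = p * q0" using q f by (simp add: eq_fract)
      hence eq: "w p0 + w q = w p + Fin b" by (metis w_mult b)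
      obtain c where c: "w q = Fin c" using w_Minf[of q] w_Pinf[of q] q(1) by (cases "w q") auto
      show ?thesis using eq c w_Minf[of p] w_Minf[of p0]
        by (cases "w p"; cases "w p0") (auto simp: algebra_simps)
    qed
    thus ?thesis by blast
  qed
  define v where "v f = (SOME e. \<forall>p q. q \<noteq> 0 \<longrightarrow> f = Fract p q \<longrightarrow> w p = e + w q)" for f
  have v: "w p = v (Fract p q) + w q" if "q \<noteq> 0" for p q
    using someI_ex[OF ex[of "Fract p q"]] that unfolding v_def by blast
  have w_one: "w 1 = Fin 0"
    using w_mult[of 1 1] w_Pinf[of 1] w_Minf[of 1] by (cases "w 1") auto
  have v_poly: "v (to_fract x) = w x" for x
    using v[of 1 x] by (simp add: to_fract_def w_one zero_extended_def[symmetric])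
  have fin: "\<exists>b. w q = Fin b" if "q \<noteq> 0" for q
    using w_Minf[of q] w_Pinf[of q] that by (cases "w q") auto
  have "krull_valuation v"
  proof
    fix x y :: "'r fract"
    obtain p q where x: "x = Fract p q" "q \<noteq> 0" by (cases x)
    obtain p' q' where y: "y = Fract p' q'" "q' \<noteq> 0" by (cases y)
    obtain b b' where b: "w q = Fin b" "w q' = Fin b'" using fin x y by metis
    have vx: "w p = v x + Fin b" and vy: "w p' = v y + Fin b'" using v x y b by metis+
    show "v x \<noteq> Minf" using vx w_Minf[of p] by (cases "v x") auto
    show "v x = Pinf \<longleftrightarrow> x = 0"
      using vx w_Pinf[of p] x by (cases "v x") (auto simp: Zero_fract_def eq_fract)
    have "w (p * p') = v (x * y) + w (q * q')" using v[of "q * q'" "p * p'"] x y by simp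
    thus "v (x * y) = v x + v y"
      unfolding w_mult b vx vy
      by (cases "v x"; cases "v y"; cases "v (x * y)") (auto simp: algebra_simps)
    have vxy: "w (p * q' + p' * q) = v (x + y) + w (q * q')"
      using v[of "q * q'" "p * q' + p' * q"] x y by simp
    have "min (w (p * q')) (w (p' * q)) \<le> w (p * q' + p' * q)" by (rule w_add)
    thus "min (v x) (v y) \<le> v (x + y)"
      unfolding vxy w_mult b vx vy
      by (cases "v x"; cases "v y"; cases "v (x + y)") (auto simp: algebra_simps min_def split: if_splits)
  qed
  with v_poly that show ?thesis by blast
qed

context krull_valuation
begin

text \<open>The valuation with centre 0 on polynomials; a centre a is reached through the Taylor
  shift \<open>p \<circ>\<^sub>p [:a, 1:]\<close>. For p = 0 the single index 0 remains and gives
  \<open>Pinf\<close>.\<close>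

definition gauss :: "'g \<Rightarrow> 'f poly \<Rightarrow> 'g extended" where
  "gauss \<gamma> p = Min ((\<lambda>i. v (Polynomial.coeff p i) + Fin (\<Sum>j<i. \<gamma>)) ` {..Polynomial.degree p})"

lemma le_add_Fin_iff: "Fin c \<le> x + Fin d \<longleftrightarrow> Fin (c - d) \<le> (x :: 'g extended)"
  by (cases x) (auto simp: algebra_simps)

text \<open>Coefficients above the degree have value \<open>Pinf\<close>, so the bound on the index
  may be dropped; this makes the condition usable for sums and products of differing
  degrees.\<close>

lemma le_gauss_iff:
  "Fin c \<le> gauss \<gamma> p \<longleftrightarrow> (\<forall>i. Fin (c - (\<Sum>j<i. \<gamma>)) \<le> v (Polynomial.coeff p i))"
proof -
  have "Fin c \<le> gauss \<gamma> p \<longleftrightarrow>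
      (\<forall>i\<le>Polynomial.degree p. Fin (c - (\<Sum>j<i. \<gamma>)) \<le> v (Polynomial.coeff p i))"
    unfolding gauss_def by (subst Min_ge_iff) (auto simp: le_add_Fin_iff)
  also have "\<dots> \<longleftrightarrow> (\<forall>i. Fin (c - (\<Sum>j<i. \<gamma>)) \<le> v (Polynomial.coeff p i))"
    by (metis coeff_eq_0 le_Pinf linorder_not_le v_zero)
  finally show ?thesis .
qed

lemma gauss_attained:
  obtains i where "gauss \<gamma> p = v (Polynomial.coeff p i) + Fin (\<Sum>j<i. \<gamma>)"
proof -
  have "gauss \<gamma> p \<in> (\<lambda>i. v (Polynomial.coeff p i) + Fin (\<Sum>j<i. \<gamma>)) ` {..Polynomial.degree p}"
    unfolding gauss_def by (rule Min_in) auto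
  with that show ?thesis by auto
qed

lemma gauss_le: "gauss \<gamma> p \<le> v (Polynomial.coeff p i) + Fin (\<Sum>j<i. \<gamma>)"
proof (cases "i \<le> Polynomial.degree p")
  case True thus ?thesis unfolding gauss_def by (intro Min_le) auto
next
  case False
  hence "v (Polynomial.coeff p i) = Pinf" by (simp add: coeff_eq_0)
  thus ?thesis by simp
qed

lemma gauss_not_Minf: "gauss \<gamma> p \<noteq> Minf"
proof -
  obtain i where "gauss \<gamma> p = v (Polynomial.coeff p i) + Fin (\<Sum>j<i. \<gamma>)"
    by (rule gauss_attained)
  thus ?thesis
    using not_Minf[of "Polynomial.coeff p i"] by (cases "v (Polynomial.coeff p i)") auto
qed

lemma gauss_zero [simp]: "gauss \<gamma> 0 = Pinf"
  by (simp add: gauss_def)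

lemma gauss_eq_Pinf_iff: "gauss \<gamma> p = Pinf \<longleftrightarrow> p = 0"
proof
  assume *: "gauss \<gamma> p = Pinf"
  show "p = 0"
  proof (rule ccontr)
    assume "p \<noteq> 0"
    hence "v (Polynomial.lead_coeff p) \<noteq> Pinf" by simp
    thus False using gauss_le[of \<gamma> p "Polynomial.degree p"] *
      by (cases "v (Polynomial.lead_coeff p)") auto
  qed
qed simp

lemma gauss_add: "min (gauss \<gamma> p) (gauss \<gamma> q) \<le> gauss \<gamma> (p + q)"
proof -
  obtain i where i: "gauss \<gamma> (p + q) = v (Polynomial.coeff (p + q) i) + Fin (\<Sum>j<i. \<gamma>)"
    by (rule gauss_attained)
  have "min (v (Polynomial.coeff p i)) (v (Polynomial.coeff q i)) \<le> v (Polynomial.coeff (p + q) i)"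
    using v_add by simp
  hence "min (v (Polynomial.coeff p i)) (v (Polynomial.coeff q i)) + Fin (\<Sum>j<i. \<gamma>) \<le> gauss \<gamma> (p + q)"
    unfolding i by (rule add_right_mono)
  thus ?thesis
    using gauss_le[of \<gamma> p i] gauss_le[of \<gamma> q i] by (auto simp: min_def split: if_splits)
qed

text \<open>Gauss's lemma: the coefficient of the product at the sum of the two least minimizing
  indices contains exactly one term of minimal value, so no cancellation can raise it.\<close>

lemma gauss_mult: "gauss \<gamma> (p * q) = gauss \<gamma> p + gauss \<gamma> q"
proof (cases "p = 0 \<or> q = 0")
  case True
  thus ?thesis using gauss_not_Minf[of \<gamma> p] gauss_not_Minf[of \<gamma> q]
    by (cases "gauss \<gamma> p"; cases "gauss \<gamma> q") auto
next
  case False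
  define S where "S i = (\<Sum>j<i. \<gamma>)" for i :: nat
  have S_add: "S (i + j) = S i + S j" for i j
    by (induction j) (simp_all add: S_def add.assoc)
  from False obtain a where a: "gauss \<gamma> p = Fin a"
    using gauss_not_Minf[of \<gamma> p] gauss_eq_Pinf_iff[of \<gamma> p] by (cases "gauss \<gamma> p") auto
  from False obtain b where b: "gauss \<gamma> q = Fin b"
    using gauss_not_Minf[of \<gamma> q] gauss_eq_Pinf_iff[of \<gamma> q] by (cases "gauss \<gamma> q") auto
  let ?p = "Polynomial.coeff p" and ?q = "Polynomial.coeff q"
  have ple: "Fin (a - S i) \<le> v (?p i)" and qle: "Fin (b - S i) \<le> v (?q i)" for i
    using le_gauss_iff[of a \<gamma> p] le_gauss_iff[of b \<gamma> q] a b by (auto simp: S_def)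
  have pq_exp: "a + b - S k = (a - S i) + (b - S (k - i))" if "i \<le> k" for i k
    using S_add[of i "k - i"] that by (simp add: algebra_simps)
  have lower: "Fin (a + b) \<le> gauss \<gamma> (p * q)"
    unfolding le_gauss_iff coeff_mult S_def[symmetric]
    by (intro allI le_v_sum) (simp add: pq_exp Fin_add_le_v_mult ple qle)
  \<comment> \<open>Least indices at which the minima a and b are attained; all smaller indices give
    strictly larger terms.\<close>
  define i0 where "i0 = (LEAST i. v (?p i) = Fin (a - S i))"
  define j0 where "j0 = (LEAST i. v (?q i) = Fin (b - S i))"
  have Fin_eqI: "x = Fin (c - d)" if "Fin c = x + Fin d" for c d and x :: "'g extended"
    using that by (cases x) (auto simp: algebra_simps)
  obtain i1 where "v (?p i1) = Fin (a - S i1)"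
    using gauss_attained[of \<gamma> p] a Fin_eqI unfolding S_def by metis
  hence i0: "v (?p i0) = Fin (a - S i0)" unfolding i0_def by (rule LeastI)
  have i0_less: "Fin (a - S i) < v (?p i)" if "i < i0" for i
    using not_less_Least[OF that[unfolded i0_def]] ple[of i] by (metis le_neq_trans)
  obtain j1 where "v (?q j1) = Fin (b - S j1)"
    using gauss_attained[of \<gamma> q] b Fin_eqI unfolding S_def by metis
  hence j0: "v (?q j0) = Fin (b - S j0)" unfolding j0_def by (rule LeastI)
  have j0_less: "Fin (b - S i) < v (?q i)" if "i < j0" for i
    using not_less_Least[OF that[unfolded j0_def]] qle[of i] by (metis le_neq_trans)
  define k where "k = i0 + j0"
  have "Fin (a + b - S k) < v (?p i * ?q (k - i))" if "i \<in> {..k} - {i0}" for i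
  proof -
    from that have "i \<le> k" by simp
    \<comment> \<open>Since k = i0 + j0, any other splitting of k has one index below its least
      minimizing index.\<close>
    have "i < i0 \<or> k - i < j0" using that unfolding k_def by auto
    then consider "i < i0" | "k - i < j0" by blast
    thus ?thesis
    proof cases
      case 1
      thus ?thesis unfolding pq_exp[OF \<open>i \<le> k\<close>] by (intro Fin_add_less_v_mult i0_less qle)
    next
      case 2
      show ?thesis unfolding pq_exp[OF \<open>i \<le> k\<close>]
        using Fin_add_less_v_mult[OF j0_less[OF 2] ple[of i]] by (simp add: add.commute mult.commute)
    qed
  qed
  hence rest: "Fin (a + b - S k) < v (\<Sum>i\<in>{..k} - {i0}. ?p i * ?q (k - i))"
    by (rule less_v_sum)
  have main: "v (?p i0 * ?q j0) = Fin (a + b - S k)"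
    unfolding v_mult i0 j0 k_def S_add by (simp add: algebra_simps)
  have "Polynomial.coeff (p * q) k = ?p i0 * ?q j0 + (\<Sum>i\<in>{..k} - {i0}. ?p i * ?q (k - i))"
    unfolding coeff_mult by (subst sum.remove[of _ i0]) (auto simp: k_def)
  hence "v (Polynomial.coeff (p * q) k) = Fin (a + b - S k)"
    using v_add_eq_left[of "?p i0 * ?q j0"] rest main by simp
  hence "gauss \<gamma> (p * q) \<le> Fin (a + b)"
    using gauss_le[of \<gamma> "p * q" k] by (simp add: S_def)
  with lower show ?thesis unfolding a b by simp
qed

lemma gauss_eq_Min:
  assumes "Polynomial.degree p \<le> n"
  shows "gauss \<gamma> p = Min ((\<lambda>i. v (Polynomial.coeff p i) + Fin (\<Sum>j<i. \<gamma>)) ` {..n})"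
proof (rule antisym)
  show "gauss \<gamma> p \<le> Min ((\<lambda>i. v (Polynomial.coeff p i) + Fin (\<Sum>j<i. \<gamma>)) ` {..n})"
    by (intro Min.boundedI) (auto simp: gauss_le)
  show "Min ((\<lambda>i. v (Polynomial.coeff p i) + Fin (\<Sum>j<i. \<gamma>)) ` {..n}) \<le> gauss \<gamma> p"
    unfolding gauss_def using assms by (intro Min_antimono) auto
qed

end

section \<open>Constants and Taylor expansions inside the rational function field\<close>

lemma rf_const_eq: "rf_const c = to_fract [:c:]"
  by (simp add: rf_const_def to_fract_def)

lemma rf_X_eq: "rf_X = to_fract [:0, 1:]"
  by (simp add: rf_X_def to_fract_def)

lemma rf_const_simps [simp]:
  "rf_const 0 = 0" "rf_const 1 = 1" "rf_const (a + b) = rf_const a + rf_const b"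
  "rf_const (a - b) = rf_const a - rf_const b" "rf_const (a * b) = rf_const a * rf_const b"
  "rf_const (- a) = - rf_const a"
  unfolding rf_const_eq
  by (simp_all flip: to_fract_add to_fract_diff to_fract_mult to_fract_uminus to_fract_1 add: one_pCons)

lemma rf_const_eq_0_iff [simp]: "rf_const a = 0 \<longleftrightarrow> a = 0"
  by (simp add: rf_const_eq)

lemma rf_const_inverse [simp]: "rf_const (inverse a) = inverse (rf_const a)"
proof (cases "a = 0")
  case False
  hence "rf_const a * rf_const (inverse a) = 1"
    unfolding rf_const_simps(5)[symmetric] by simp
  thus ?thesis by (metis inverse_unique)
qed simp

lemma rf_const_power [simp]: "rf_const (a ^ n) = rf_const a ^ n"
  by (induction n) simp_all

lemma rf_const_sum [simp]: "rf_const (sum f A) = (\<Sum>x\<in>A. rf_const (f x))"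
  by (induction A rule: infinite_finite_induct) simp_all

lemma to_fract_power [simp]: "to_fract (a ^ n) = to_fract a ^ n"
  by (induction n) simp_all

lemma to_fract_linear: "to_fract [:- a, 1:] = rf_X - rf_const a"
  by (simp add: rf_X_eq rf_const_eq flip: to_fract_diff)

lemma rf_X_minus_const_nonzero [simp]: "rf_X - rf_const a \<noteq> 0"
  by (simp flip: to_fract_linear)

lemma to_fract_smult [simp]: "to_fract (Polynomial.smult c p) = rf_const c * to_fract p"
  by (simp add: rf_const_eq flip: to_fract_mult)

lemma pcompose_monom: "Polynomial.monom c n \<circ>\<^sub>p r = [:c:] * r ^ n"
  by (induction n) (simp_all add: monom_0 monom_Suc pcompose_pCons mult.left_commute)

lemma to_fract_pcompose_linear:
  "to_fract (pcompose (\<Sum>i\<le>n. Polynomial.monom (C i) i) [:- a, 1:]) =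
     (\<Sum>i\<le>(n::nat). rf_const (C i) * (rf_X - rf_const a) ^ i)"
  by (simp add: pcompose_sum pcompose_monom to_fract_linear)

lemma pcompose_linear_inverse:
  fixes a :: "'a::comm_ring_1"
  shows "(p \<circ>\<^sub>p [:a, 1:]) \<circ>\<^sub>p [:- a, 1:] = p" "(p \<circ>\<^sub>p [:- a, 1:]) \<circ>\<^sub>p [:a, 1:] = p"
  by (simp_all add: pcompose_pCons flip: pcompose_assoc)

lemma to_fract_taylor:
  obtains C n where "to_fract p = (\<Sum>i\<le>(n::nat). rf_const (C i) * (rf_X - rf_const a) ^ i)"
proof -
  let ?q = "p \<circ>\<^sub>p [:a, 1:]"
  have "to_fract p = to_fract (pcompose (\<Sum>i\<le>Polynomial.degree ?q. Polynomial.monom (Polynomial.coeff ?q i) i) [:- a, 1:])"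
    by (simp add: poly_as_sum_of_monoms pcompose_linear_inverse)
  with that show ?thesis unfolding to_fract_pcompose_linear by blast
qed

lemma krull_valuation_eqI:
  assumes "krull_valuation v" "krull_valuation w" "\<And>p. v (to_fract p) = w (to_fract p)"
  shows "v = (w :: 'r::idom fract \<Rightarrow> _)"
proof
  interpret V: krull_valuation v by fact
  interpret W: krull_valuation w by fact
  fix f :: "'r fract"
  obtain p q where f: "f = Fract p q" "q \<noteq> 0" by (cases f)
  hence f': "to_fract p = f * to_fract q" by (simp add: Fract_conv_to_fract)
  obtain b where b: "v (to_fract q) = Fin b" using V.v_finite f(2) by (metis to_fract_eq_0_iff)
  have "v f + Fin b = w f + Fin b"
    using V.v_mult[of f "to_fract q"] W.v_mult[of f "to_fract q"] assms(3) b f' by metis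
  thus "v f = w f" by (cases "v f"; cases "w f") auto
qed

context krull_valuation
begin

text \<open>This discharges the \<open>THE\<close> in the definition. Existence: the shifted Gauss
  value is multiplicative and extends to fractions. Uniqueness: every polynomial has a Taylor
  expansion at a, and a valuation is determined by its values on polynomials.\<close>

lemma monomial_valuation_characterization:
  fixes \<gamma> :: 'g and a :: 'f
  defines "w \<equiv> monomial_valuation v a \<gamma>"
  shows "krull_valuation w" "\<And>p. w (to_fract p) = gauss \<gamma> (p \<circ>\<^sub>p [:a, 1:])"
proof -
  let ?P = "\<lambda>w. valuation type_field w \<and>
       (\<forall>(n::nat) C. w (\<Sum>i\<le>n. rf_const (C i) * (rf_X - rf_const a) ^ i) =
                     Min ((\<lambda>i. v (C i) + Fin (\<Sum>j<i. \<gamma>)) ` {..n}))"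
  let ?g = "\<lambda>p. gauss \<gamma> (p \<circ>\<^sub>p [:a, 1:])"
  obtain w0 where w0: "krull_valuation w0" "\<And>p. w0 (to_fract p) = ?g p"
  proof (rule exists_valuation_on_fract[of ?g])
    show "?g x = Pinf \<longleftrightarrow> x = 0" for x
      using pcompose_linear_inverse(1)[of x a] by (auto simp: gauss_eq_Pinf_iff)
  qed (auto simp: gauss_not_Minf gauss_add gauss_mult pcompose_add pcompose_mult)
  have "?P w0"
    unfolding valuation_type_field_iff
  proof (intro conjI allI w0(1))
    fix n :: nat and C :: "nat \<Rightarrow> 'f"
    let ?q = "\<Sum>i\<le>n. Polynomial.monom (C i) i"
    have "Polynomial.degree ?q \<le> n"
      by (intro degree_sum_le) (auto intro: order_trans[OF degree_monom_le])
    hence "gauss \<gamma> ?q = Min ((\<lambda>i. v (Polynomial.coeff ?q i) + Fin (\<Sum>j<i. \<gamma>)) ` {..n})"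
      by (rule gauss_eq_Min)
    also have "(\<lambda>i. v (Polynomial.coeff ?q i) + Fin (\<Sum>j<i. \<gamma>)) ` {..n} =
        (\<lambda>i. v (C i) + Fin (\<Sum>j<i. \<gamma>)) ` {..n}"
      by (intro image_cong) (auto simp: coeff_sum sum.delta)
    finally show "w0 (\<Sum>i\<le>n. rf_const (C i) * (rf_X - rf_const a) ^ i) =
                     Min ((\<lambda>i. v (C i) + Fin (\<Sum>j<i. \<gamma>)) ` {..n})"
      unfolding to_fract_pcompose_linear[symmetric] w0(2) pcompose_linear_inverse .
  qed
  moreover have "w' = w0" if "?P w'" for w'
  proof (rule krull_valuation_eqI[OF _ w0(1)])
    show "krull_valuation w'" using that by (simp add: valuation_type_field_iff)
    show "w' (to_fract p) = w0 (to_fract p)" for p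
      using that \<open>?P w0\<close> by (rule_tac to_fract_taylor[of p a]) simp
  qed
  ultimately have "w = w0"
    unfolding w_def monomial_valuation_def by (rule the_equality)
  with w0 show "krull_valuation w" "\<And>p. w (to_fract p) = gauss \<gamma> (p \<circ>\<^sub>p [:a, 1:])" by simp_all
qed

lemma gauss_linear: "gauss \<gamma> [:c, d:] = min (v c) (v d + Fin \<gamma>)"
proof -
  have "gauss \<gamma> [:c, d:] = Min ((\<lambda>i. v (Polynomial.coeff [:c, d:] i) + Fin (\<Sum>j<i. \<gamma>)) ` {..1})"
    by (rule gauss_eq_Min) auto
  also have "{..1::nat} = {0, 1}" by auto
  finally show ?thesis by (simp flip: zero_extended_def)
qed

lemma monomial_valuation_linear:
  "monomial_valuation v a \<gamma> (rf_X - rf_const b) = min (v (a - b)) (Fin \<gamma>)"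
  unfolding to_fract_linear[symmetric] monomial_valuation_characterization(2)
  by (simp add: pcompose_pCons gauss_linear)

lemma monomial_valuation_const: "monomial_valuation v a \<gamma> (rf_const c) = v c"
  using gauss_linear[of \<gamma> c 0]
  unfolding rf_const_eq monomial_valuation_characterization(2) by simp

end

lemma krull_valuation_const:
  assumes "krull_valuation v"
  shows "krull_valuation (v \<circ> rf_const)"
proof -
  interpret krull_valuation v by fact
  show ?thesis by unfold_locales (use not_Minf v_add in \<open>auto simp: v_mult\<close>)
qed

text \<open>The bridge between pairs of definition and maxima. Both valuations agree on constants
  and on linear polynomials, and over an algebraically closed field of constants these generate all
  polynomials multiplicatively.\<close>

lemma eq_monomial_valuation_iff:
  fixes v :: "'c::alg_closed_field poly fract \<Rightarrow> 'g::linordered_ab_group_add extended"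
  assumes "krull_valuation v"
  shows "v = monomial_valuation (v \<circ> rf_const) a \<gamma> \<longleftrightarrow>
    v (rf_X - rf_const a) = Fin \<gamma> \<and> (\<forall>b. v (rf_X - rf_const b) \<le> Fin \<gamma>)"
proof -
  interpret krull_valuation v by fact
  interpret U: krull_valuation "v \<circ> rf_const" using assms by (rule krull_valuation_const)
  let ?w = "monomial_valuation (v \<circ> rf_const) a \<gamma>"
  interpret W: krull_valuation ?w by (rule U.monomial_valuation_characterization)
  show ?thesis
  proof
    assume "v = ?w"
    hence "v (rf_X - rf_const b) = min (v (rf_const (a - b))) (Fin \<gamma>)" for b
      using U.monomial_valuation_linear[of a \<gamma> b] by simp
    thus "v (rf_X - rf_const a) = Fin \<gamma> \<and> (\<forall>b. v (rf_X - rf_const b) \<le> Fin \<gamma>)"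
      by simp
  next
    assume *: "v (rf_X - rf_const a) = Fin \<gamma> \<and> (\<forall>b. v (rf_X - rf_const b) \<le> Fin \<gamma>)"
    have lin: "v (rf_X - rf_const b) = ?w (rf_X - rf_const b)" for b
    proof -
      have eq: "rf_X - rf_const b = (rf_X - rf_const a) + rf_const (a - b)" by simp
      \<comment> \<open>Write X - b = (X - a) + (a - b). If v(a - b) < \<gamma> the smaller value
        wins; otherwise the sum has value at least \<gamma>, and maximality forces equality.\<close>
      have "v (rf_X - rf_const b) = min (v (rf_const (a - b))) (Fin \<gamma>)"
      proof (cases "v (rf_const (a - b)) < Fin \<gamma>")
        case True
        thus ?thesis
          using * v_add_eq_left[of "rf_const (a - b)" "rf_X - rf_const a"] by (simp add: min_def less_imp_le)
      next
        case False
        hence "Fin \<gamma> \<le> v (rf_X - rf_const b)"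
          unfolding eq using * by (intro le_v_add) auto
        with * False show ?thesis by (intro antisym) (auto simp: min_def)
      qed
      thus ?thesis using U.monomial_valuation_linear[of a \<gamma> b] by simp
    qed
    have const: "v (rf_const c) = ?w (rf_const c)" for c
      using U.monomial_valuation_const[of a \<gamma> c] by simp
    have "v (to_fract p) = ?w (to_fract p)" for p
    proof (induction "Polynomial.degree p" arbitrary: p)
      case 0
      then obtain c where "p = [:c:]" by (metis degree_eq_zeroE)
      hence "to_fract p = rf_const c" by (simp add: rf_const_eq)
      with const[of c] show ?case by (simp only:)
    next
      case (Suc n)
      then obtain b where "poly p b = 0" using alg_closed_imp_poly_has_root[of p] by auto
      then obtain q where q: "p = [:- b, 1:] * q" by (auto simp: poly_eq_0_iff_dvd)
      with Suc(2) have "q \<noteq> 0" by auto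
      hence "Polynomial.degree p = Suc (Polynomial.degree q)"
        unfolding q by (subst degree_mult_eq) auto
      with Suc(2) have "n = Polynomial.degree q" by simp
      from Suc(1)[OF this] show ?case
        unfolding q to_fract_mult to_fract_linear v_mult W.v_mult lin by (simp only:)
    qed
    thus "v = ?w" by (intro krull_valuation_eqI assms W.krull_valuation_axioms)
  qed
qed


section \<open>Polynomials over a subfield\<close>

definition poly_over :: "'a::zero set \<Rightarrow> 'a poly \<Rightarrow> bool" where
  "poly_over F p \<longleftrightarrow> (\<forall>i. Polynomial.coeff p i \<in> F)"

context
  fixes F :: "'a::field set"
  assumes F: "subfield F type_field"
begin

lemma subfield_type_field_closed:
  shows subfield_zero: "0 \<in> F" and subfield_one: "1 \<in> F"
    and subfield_add: "\<And>x y. x \<in> F \<Longrightarrow> y \<in> F \<Longrightarrow> x + y \<in> F"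
    and subfield_mult: "\<And>x y. x \<in> F \<Longrightarrow> y \<in> F \<Longrightarrow> x * y \<in> F"
    and subfield_uminus: "\<And>x. x \<in> F \<Longrightarrow> - x \<in> F"
    and subfield_diff: "\<And>x y. x \<in> F \<Longrightarrow> y \<in> F \<Longrightarrow> x - y \<in> F"
    and subfield_inverse: "\<And>x. x \<in> F \<Longrightarrow> inverse x \<in> F"
    and subfield_divide: "\<And>x y. x \<in> F \<Longrightarrow> y \<in> F \<Longrightarrow> x / y \<in> F"
proof -
  note R = subringE[OF subfieldE(1)[OF F]]
  show z: "0 \<in> F" and "1 \<in> F"
    and a: "\<And>x y. x \<in> F \<Longrightarrow> y \<in> F \<Longrightarrow> x + y \<in> F"
    and m: "\<And>x y. x \<in> F \<Longrightarrow> y \<in> F \<Longrightarrow> x * y \<in> F"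
    and n: "\<And>x. x \<in> F \<Longrightarrow> - x \<in> F"
    using R by simp_all
  show "x - y \<in> F" if "x \<in> F" "y \<in> F" for x y
    using a[OF that(1) n[OF that(2)]] by simp
  show i: "inverse x \<in> F" if "x \<in> F" for x
    using ring.subfield_m_inv(1)[OF ring_type_field F, of x] that z by (cases "x = 0") auto
  show "x / y \<in> F" if "x \<in> F" "y \<in> F" for x y
    using m[OF that(1) i[OF that(2)]] by (simp add: divide_inverse)
qed

lemma subfield_sum: "(\<And>i. i \<in> A \<Longrightarrow> f i \<in> F) \<Longrightarrow> sum f A \<in> F"
  by (induction A rule: infinite_finite_induct) (auto intro: subfield_zero subfield_add)

lemma poly_over_closed:
  shows poly_over_const: "c \<in> F \<Longrightarrow> poly_over F [:c:]"
    and poly_over_pCons: "c \<in> F \<Longrightarrow> poly_over F p \<Longrightarrow> poly_over F (pCons c p)"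
    and poly_over_add: "poly_over F p \<Longrightarrow> poly_over F q \<Longrightarrow> poly_over F (p + q)"
    and poly_over_uminus: "poly_over F p \<Longrightarrow> poly_over F (- p)"
    and poly_over_mult: "poly_over F p \<Longrightarrow> poly_over F q \<Longrightarrow> poly_over F (p * q)"
  by (auto simp: poly_over_def coeff_pCons coeff_mult subfield_zero subfield_add subfield_mult
      subfield_uminus intro!: subfield_sum split: nat.splits)

end

lemma poly_over_mono: "F \<subseteq> E \<Longrightarrow> poly_over F p \<Longrightarrow> poly_over E p"
  by (auto simp: poly_over_def)

text \<open>Polynomials of HOL-Algebra are lists beginning with the leading coefficient, whereas
  \<open>Poly\<close> expects the constant coefficient first; hence the reversal here and
  below.\<close>

lemma eval_type_field: "ring.eval type_field l x = poly (Poly (rev l)) (x :: 'a::field)"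
proof (induction l)
  case Nil thus ?case by (simp add: ring.eval.simps[OF ring_type_field])
next
  case (Cons a l)
  thus ?case by (simp add: ring.eval.simps[OF ring_type_field] Poly_snoc poly_monom)
qed

lemma Poly_rev_polynomial:
  assumes "polynomial\<^bsub>type_field\<^esub> F l" "l \<noteq> []" "0 \<in> F"
  shows "Poly (rev l) \<noteq> (0 :: 'a::field poly)" "poly_over F (Poly (rev l))"
    "Polynomial.degree (Poly (rev l)) = length l - 1" "Polynomial.lead_coeff (Poly (rev l)) = hd l"
proof -
  obtain a l' where l: "l = a # l'" using assms by (cases l) auto
  have a: "a \<noteq> 0" "set l \<subseteq> F" using assms l by (auto simp: polynomial_def)
  have "coeffs (Poly (rev l)) = rev l"
    using a l by simp
  hence *: "rev l = coeffs (Poly (rev l))" by simp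
  show "Polynomial.degree (Poly (rev l)) = length l - 1"
    unfolding degree_eq_length_coeffs *[symmetric] by simp
  show nz: "Poly (rev l) \<noteq> 0" using * l by (metis coeffs_0_eq_Nil list.distinct(1) rev_is_Nil_conv)
  show "Polynomial.lead_coeff (Poly (rev l)) = hd l"
    using last_coeffs_eq_coeff_degree[of "Poly (rev l)"] nz l a(1) by simp
  show "poly_over F (Poly (rev l))"
    using a assms(3) by (auto simp: poly_over_def nth_default_def subset_iff)
      (metis length_rev nth_mem set_rev)
qed

lemma rev_coeffs_polynomial:
  assumes "poly_over F p" "p \<noteq> 0"
  shows "rev (coeffs p) \<in> carrier (univ_poly type_field F)" "rev (coeffs p) \<noteq> []"
    "ring.eval type_field (rev (coeffs p)) x = poly p (x :: 'a::field)"
proof -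
  show "rev (coeffs p) \<in> carrier (univ_poly type_field F)"
    using assms by (auto simp: univ_poly_carrier[symmetric] polynomial_def poly_over_def
      coeffs_def hd_rev last_map)
qed (use assms in \<open>auto simp: eval_type_field\<close>)

lemma algebraic_closure_of_iff:
  assumes "subfield F (type_field :: 'a::field ring)"
  shows "a \<in> algebraic_closure_of F \<longleftrightarrow> (\<exists>p. p \<noteq> 0 \<and> poly_over F p \<and> poly p a = 0)"
proof
  interpret R: Ring.field "type_field :: 'a ring" by (rule field_type_field)
  {
    assume "a \<in> algebraic_closure_of F"
    hence "(R.algebraic over F) a" by (simp add: algebraic_closure_of_def over_def)
    then obtain l where "l \<in> carrier (univ_poly type_field F)" "l \<noteq> []" "R.eval l a = 0"
      using R.algebraicE[OF subfieldE(1)[OF assms], of a] by auto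
    thus "\<exists>p. p \<noteq> 0 \<and> poly_over F p \<and> poly p a = 0"
      using Poly_rev_polynomial[of F l] subfield_zero[OF assms]
      by (auto simp: eval_type_field univ_poly_carrier[symmetric])
  }
  assume "\<exists>p. p \<noteq> 0 \<and> poly_over F p \<and> poly p a = 0"
  then obtain p where "p \<noteq> 0" "poly_over F p" "poly p a = 0" by blast
  thus "a \<in> algebraic_closure_of F"
    using R.algebraicI[where p = "rev (coeffs p)" and K = F and x = a] rev_coeffs_polynomial[of F p]
    by (auto simp: algebraic_closure_of_def over_def)
qed

context
  fixes F :: "'a::field set" and a :: 'a
  assumes F: "subfield F type_field" and a: "a \<in> algebraic_closure_of F"
begin

interpretation R: Ring.field "type_field :: 'a ring" by (rule field_type_field)

lemma algebraic_over: "(R.algebraic over F) a"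
  using a by (simp add: algebraic_closure_of_def over_def)

text \<open>For algebraic a the ring F[a] is already a field, so it is the generated field, and its
  dimension is the degree of the minimal polynomial.\<close>

lemma simple_ext_degree_eq_Irr: "simple_ext_degree F a = length (R.Irr F a) - 1"
proof -
  have "R.simple_extension F a = generate_field type_field (F \<union> {a})"
  proof (rule R.generate_fieldI)
    show "subfield (R.simple_extension F a) type_field"
      using R.simple_extension_is_subfield[OF F] algebraic_over by simp
    show "F \<union> {a} \<subseteq> R.simple_extension F a"
      using R.simple_extension_incl[of F a] R.simple_extension_mem[OF subfieldE(1)[OF F], of a] by simp
    show "R.simple_extension F a \<subseteq> K" if "subfield K type_field" "F \<union> {a} \<subseteq> K" for K
      using that by (intro R.simple_extension_subring_incl subfieldE(1)) auto
  qed auto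
  thus ?thesis
    using R.simple_extension_dim[OF F _ algebraic_over]
    by (simp add: simple_ext_degree_def over_def)
qed

lemma simple_ext_degree_le_degree:
  assumes "p \<noteq> 0" "poly_over F p" "poly p a = 0"
  shows "simple_ext_degree F a \<le> Polynomial.degree p"
proof -
  have "R.Irr F a pdivides\<^bsub>type_field\<^esub> rev (coeffs p)"
    using rev_coeffs_polynomial[OF assms(2,1)] assms(3)
    by (intro R.Irr_minimal F algebraic_over) auto
  hence "length (R.Irr F a) - 1 \<le> length (rev (coeffs p)) - 1"
    using rev_coeffs_polynomial[OF assms(2,1)] R.IrrE(1)[OF F _ algebraic_over]
    by (intro R.pdivides_imp_degree_le[OF subfieldE(1)[OF F]]) auto
  thus ?thesis
    unfolding simple_ext_degree_eq_Irr degree_eq_length_coeffs by simp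
qed

lemma minimal_polynomial_exists:
  obtains p where "poly_over F p" "Polynomial.lead_coeff p = 1" "poly p a = 0"
    "Polynomial.degree p = simple_ext_degree F a" "0 < Polynomial.degree p"
proof -
  note Irr = R.IrrE[OF F _ algebraic_over]
  have "length (R.Irr F a) > 1"
    using R.pirreducible_degree[OF F Irr(1,2)] by simp
  moreover from this have "R.Irr F a \<noteq> []" by auto
  ultimately show ?thesis using Irr that[of "Poly (rev (R.Irr F a))"] Poly_rev_polynomial[of F "R.Irr F a"]
    by (simp add: univ_poly_carrier simple_ext_degree_eq_Irr eval_type_field subfield_zero[OF F])
qed

end

lemma infinite_UNIV_alg_closed: "infinite (UNIV :: 'a::alg_closed_field set)"
proof
  assume fin: "finite (UNIV :: 'a set)"
  define p where "p = (\<Prod>x\<in>(UNIV :: 'a set). [:- x, 1:])"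
  have deg: "Polynomial.degree p = card (UNIV :: 'a set)"
    unfolding p_def by (subst degree_prod_eq_sum_degree) auto
  have "card (UNIV :: 'a set) > 0" using fin by (simp add: card_gt_0_iff)
  hence "Polynomial.degree (p + 1) > 0"
    using deg by (subst degree_add_eq_left) auto
  then obtain x where "poly (p + 1) x = 0" using alg_closed_imp_poly_has_root by blast
  moreover have "poly p x = 0" using fin unfolding p_def poly_prod by (intro prod_zero) auto
  ultimately show False by simp
qed

text \<open>Serves to carry a factorization of list polynomials over to \<open>poly\<close> by
  comparing evaluations.\<close>

lemma poly_eqI_alg_closed:
  fixes p q :: "'a::alg_closed_field poly"
  assumes "\<And>x. poly p x = poly q x"
  shows "p = q"
proof (rule ccontr)
  assume "p \<noteq> q"
  hence "finite {x. poly (p - q) x = 0}" by (intro poly_roots_finite) auto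
  thus False using assms infinite_UNIV_alg_closed[where 'a = 'a] by simp
qed

text \<open>The minimal polynomial of a divides p, so a double root of it would yield a square
  factor of p. Hence any annihilating polynomial with simple roots will do, irreducible or
  not.\<close>

lemma separable_closure_ofI:
  fixes a :: "'a::alg_closed_field"
  assumes F: "subfield F type_field" and p: "p \<noteq> 0" "poly_over F p" "poly p a = 0"
    and simple: "\<And>x. \<not> [:- x, 1:] ^ 2 dvd p"
  shows "a \<in> separable_closure_of F"
proof -
  interpret R: Ring.field "type_field :: 'a ring" by (rule field_type_field)
  interpret UP: domain "poly_ring (type_field :: 'a ring)"
    using R.univ_poly_is_domain[OF R.carrier_is_subring] .
  have a: "a \<in> algebraic_closure_of F" using p by (auto simp: algebraic_closure_of_iff[OF F])
  note alg = algebraic_over[OF F a]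
  note Irr = R.IrrE[OF F _ alg]
  have mult: "R.alg_mult (R.Irr F a) x \<le> 1" for x
  proof (rule ccontr)
    assume "\<not> ?thesis"
    hence ge: "2 \<le> R.alg_mult (R.Irr F a) x" by simp
    let ?l = "[1, - x] :: 'a list"
    have l: "?l \<in> carrier (poly_ring type_field)"
      by (auto simp: univ_poly_carrier[symmetric] polynomial_def)
    have carr: "carrier (univ_poly type_field F) \<subseteq> carrier (poly_ring (type_field :: 'a ring))"
      by (auto simp: univ_poly_carrier[symmetric] polynomial_def)
    have Irr_carr: "R.Irr F a \<in> carrier (poly_ring type_field)" using Irr(1) carr by auto
    have p_carr: "rev (coeffs p) \<in> carrier (poly_ring type_field)"
      using rev_coeffs_polynomial(1)[OF p(2,1)] carr by auto
    let ?D = "(divides\<^bsub>poly_ring (type_field :: 'a ring)\<^esub>)"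
    let ?n = "R.alg_mult (R.Irr F a) x"
    have "?l [^]\<^bsub>poly_ring type_field\<^esub> (2::nat) \<otimes>\<^bsub>poly_ring type_field\<^esub>
        ?l [^]\<^bsub>poly_ring type_field\<^esub> (?n - 2) = ?l [^]\<^bsub>poly_ring type_field\<^esub> ?n"
      using UP.nat_pow_mult[OF l, of 2 "?n - 2"] ge by (simp only: le_add_diff_inverse)
    hence "?D (?l [^]\<^bsub>poly_ring type_field\<^esub> (2::nat)) (?l [^]\<^bsub>poly_ring type_field\<^esub> ?n)"
      using UP.nat_pow_closed[OF l, of "?n - 2"] by (metis dividesI)
    moreover have "?D (?l [^]\<^bsub>poly_ring type_field\<^esub> ?n) (R.Irr F a)"
      using R.alg_multE(1)[of x "R.Irr F a"] Irr_carr R.pirreducible_degree[OF F Irr(1,2)]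
      by (cases "R.Irr F a") (auto simp: pdivides_def)
    moreover have "?D (R.Irr F a) (rev (coeffs p))"
      using R.Irr_minimal[OF F _ alg, of "rev (coeffs p)"] rev_coeffs_polynomial[OF p(2,1)] p(3)
      by (simp add: pdivides_def)
    ultimately have "?D (?l [^]\<^bsub>poly_ring type_field\<^esub> (2::nat)) (rev (coeffs p))"
      using UP.nat_pow_closed[OF l] UP.divides_trans by meson
    then obtain q where q: "q \<in> carrier (poly_ring type_field)"
      "rev (coeffs p) = ?l [^]\<^bsub>poly_ring type_field\<^esub> (2::nat) \<otimes>\<^bsub>poly_ring type_field\<^esub> q"
      unfolding factor_def by blast
    have "poly p y = poly ([:- x, 1:] ^ 2 * Poly (rev q)) y" for y
    proof -
      interpret E: ring_hom_ring "poly_ring (type_field :: 'a ring)" type_field "\<lambda>r. R.eval r y"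
        by (rule R.eval_ring_hom[OF R.carrier_is_subring]) simp
      have "poly p y = R.eval (rev (coeffs p)) y" 
        using rev_coeffs_polynomial(3)[OF p(2,1)] by simp
      also have "\<dots> = R.eval ?l y ^ 2 * R.eval q y"
        unfolding q(2) E.hom_mult[OF UP.nat_pow_closed[OF l] q(1)] E.hom_nat_pow[OF l]
        by (simp only: type_field_simps type_field_nat_pow)
      also have "R.eval ?l y = y - x" by (simp add: R.eval.simps)
      finally show ?thesis by (simp add: eval_type_field poly_power)
    qed
    hence "p = [:- x, 1:] ^ 2 * Poly (rev q)" by (rule poly_eqI_alg_closed)
    with simple[of x] show False by simp
  qed
  with a show ?thesis by (simp add: separable_closure_of_def)
qed


section \<open>Tensoring torsion groups with the rationals\<close>

text \<open>If n annihilates x, then x \<otimes> q = x \<otimes> n (q / n) = n x \<otimes> q / n =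
  0, so every free generator is a relation.\<close>

lemma tensor_rat_torsion_trivial:
  assumes M: "group M"
    and torsion: "\<And>x. x \<in> carrier M \<Longrightarrow> \<exists>n>0. x [^]\<^bsub>M\<^esub> (n::nat) = \<one>\<^bsub>M\<^esub>"
  shows "tensor_rat_rel M = carrier (tensor_rat_free M)"
proof -
  interpret M: group M by fact
  let ?S = "carrier M \<times> (UNIV :: rat set)"
  let ?rel = "tensor_rat_rel M"
  interpret Fr: group "tensor_rat_free M" by (simp add: tensor_rat_free_def)
  let ?gens = "{frag_of (x \<otimes>\<^bsub>M\<^esub> y, q) - frag_of (x, q) - frag_of (y, q) | x y q.
         x \<in> carrier M \<and> y \<in> carrier M} \<union>
      {frag_of (x, p + q) - frag_of (x, p) - frag_of (x, q) | x p q. x \<in> carrier M}"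
  have gens: "?gens \<subseteq> carrier (tensor_rat_free M)"
  proof -
    have "Poly_Mapping.keys (frag_of a - frag_of b - frag_of c) \<subseteq> ?S"
      if "a \<in> ?S" "b \<in> ?S" "c \<in> ?S" for a b c :: "'a \<times> rat"
      using that keys_diff[of "frag_of a - frag_of b" "frag_of c"] keys_diff[of "frag_of a" "frag_of b"]
      by auto
    thus ?thesis by (auto simp: tensor_rat_free_def)
  qed
  hence sub: "?rel \<subseteq> carrier (tensor_rat_free M)"
    unfolding tensor_rat_rel_def by (rule Fr.generate_incl)
  have zero: "0 \<in> ?rel"
    using generate.one[of "tensor_rat_free M"] by (simp add: tensor_rat_rel_def tensor_rat_free_def)
  have add: "a + b \<in> ?rel" if "a \<in> ?rel" "b \<in> ?rel" for a b
    using generate.eng[of a "tensor_rat_free M" _ b] that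
    by (simp add: tensor_rat_rel_def tensor_rat_free_def)
  have minus: "- a \<in> ?rel" if "a \<in> ?rel" for a
  proof -
    have "inv\<^bsub>tensor_rat_free M\<^esub> a \<in> ?rel"
      unfolding tensor_rat_rel_def
      by (rule Fr.generate_m_inv_closed[OF gens that[unfolded tensor_rat_rel_def]])
    moreover have "inv\<^bsub>tensor_rat_free M\<^esub> a = - a"
      using sub that by (auto simp: tensor_rat_free_def)
    ultimately show ?thesis by simp
  qed
  have diff: "a - b \<in> ?rel" if "a \<in> ?rel" "b \<in> ?rel" for a b
    using add[OF that(1) minus[OF that(2)]] by simp
  have rel1: "frag_of (x \<otimes>\<^bsub>M\<^esub> y, q) - frag_of (x, q) - frag_of (y, q) \<in> ?rel"
    if "x \<in> carrier M" "y \<in> carrier M" for x y q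
    unfolding tensor_rat_rel_def by (rule generate.incl) (use that in blast)
  have rel2: "frag_of (x, p + q) - frag_of (x, p) - frag_of (x, q) \<in> ?rel"
    if "x \<in> carrier M" for x p q
    unfolding tensor_rat_rel_def by (rule generate.incl) (use that in blast)
  \<comment> \<open>For x = y = 1 the first relation reads (1, q) - (1, q) - (1, q), the negative of
    the claim.\<close>
  have one: "frag_of (\<one>\<^bsub>M\<^esub>, q) \<in> ?rel" for q
    using minus[OF rel1[of "\<one>\<^bsub>M\<^esub>" "\<one>\<^bsub>M\<^esub>" q]] by simp
  \<comment> \<open>A natural number factor moves across the tensor sign, by induction from both
    kinds of relations.\<close>
  have shift: "frag_of (x [^]\<^bsub>M\<^esub> n, r) - frag_of (x, of_nat n * r) \<in> ?rel"
    if x: "x \<in> carrier M" for x r and n :: nat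
  proof (induction n)
    case 0
    show ?case using diff[OF one[of r] minus[OF rel2[OF x, of 0 0]]] by simp
  next
    case (Suc n)
    from add[OF diff[OF rel1[of "x [^]\<^bsub>M\<^esub> n" x r] rel2[OF x, of "of_nat n * r" r]] Suc] x
    show ?case by (simp add: algebra_simps)
  qed
  have of: "frag_of a \<in> ?rel" if "a \<in> ?S" for a
  proof -
    from that obtain x q where a: "a = (x, q)" "x \<in> carrier M" by auto
    obtain n where n: "n > 0" "x [^]\<^bsub>M\<^esub> (n::nat) = \<one>\<^bsub>M\<^esub>" using torsion a by blast
    have "frag_of (\<one>\<^bsub>M\<^esub>, q / of_nat n) - frag_of (x, q) \<in> ?rel"
      using shift[OF a(2), of n "q / of_nat n"] n by simp
    from diff[OF one[of "q / of_nat n"] this] show ?thesis by (simp add: a)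
  qed
  have "c \<in> ?rel" if "Poly_Mapping.keys c \<subseteq> ?S" for c
    using that by (induction c rule: frag_induction) (auto intro: zero diff of)
  thus ?thesis using sub by (auto simp: tensor_rat_free_def)
qed

text \<open>The tensor product has a single element, so a one-element basis would consist of zero;
  then the coefficients 0 and 1 represent the same element, against uniqueness.\<close>

lemma torsion_imp_not_tensor_rat_dim_1:
  assumes M: "group M"
    and torsion: "\<And>x. x \<in> carrier M \<Longrightarrow> \<exists>n>0. x [^]\<^bsub>M\<^esub> (n::nat) = \<one>\<^bsub>M\<^esub>"
  shows "\<not> has_tensor_rat_dim M 1"
proof
  assume "has_tensor_rat_dim M 1"
  then obtain B where B: "tensor_rat_basis M B" "card B = 1"
    by (auto simp: has_tensor_rat_dim_def)
  interpret Fr: comm_group "tensor_rat_free M"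
    by (simp add: tensor_rat_free_def abelian_free_Abelian_group)
  define T where "T = carrier (tensor_rat_free M)"
  have rel: "tensor_rat_rel M = T" unfolding T_def by (rule tensor_rat_torsion_trivial[OF M torsion])
  have coset: "T #>\<^bsub>tensor_rat_free M\<^esub> z = T" if "z \<in> T" for z
    using that Fr.coset_join2[of z T] Fr.subgroup_self unfolding T_def by simp
  have carr: "carrier (tensor_rat M) = {T}"
    unfolding tensor_rat_def carrier_FactGroup rel using coset Fr.one_closed
    by (auto simp: T_def)
  have "T \<lhd> tensor_rat_free M"
    unfolding T_def using Fr.subgroup_self Fr.normal_iff_subgroup by blast
  hence "group (tensor_rat M)"
    unfolding tensor_rat_def rel by (rule normal.factorgroup_is_group)
  then interpret Te: comm_group "tensor_rat M"
    by (rule group.group_comm_groupI) (simp add: carr)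
  have "B \<subseteq> {T}" using B(1) by (simp add: tensor_rat_basis_def carr)
  with B(2) have BT: "B = {T}" by (metis card.empty subset_singletonD zero_neq_one)
  have smult: "tensor_rat_smult M r T = T" for r
  proof -
    have "frag_extend (\<lambda>(x, q). frag_of (x, r * q)) z \<in> T" if "z \<in> T" for z
    proof -
      have "Poly_Mapping.keys z \<subseteq> carrier M \<times> UNIV"
        using that by (simp add: T_def tensor_rat_free_def)
      thus ?thesis
        using keys_frag_extend[of "\<lambda>(x, q). frag_of (x, r * q)" z]
        by (fastforce simp: T_def tensor_rat_free_def)
    qed
    moreover have "T \<noteq> {}" unfolding T_def using Fr.one_closed by blast
    ultimately show ?thesis
      unfolding tensor_rat_smult_def rel by (simp add: coset)
  qed
  have fp: "T = finprod (tensor_rat M) (\<lambda>b. tensor_rat_smult M (c b) b) B" for c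
    using Te.finprod_closed[of "\<lambda>b. tensor_rat_smult M (c b) b" B] by (simp add: BT smult carr)
  have "\<exists>!c. c \<in> extensional B \<and> T = finprod (tensor_rat M) (\<lambda>b. tensor_rat_smult M (c b) b) B"
    using B(1) by (simp add: tensor_rat_basis_def carr)
  moreover have "restrict (\<lambda>_. 0) B \<in> extensional B" "restrict (\<lambda>_. 1 :: rat) B \<in> extensional B"
    by simp_all
  ultimately have "restrict (\<lambda>_. 0 :: rat) B = restrict (\<lambda>_. 1) B"
    using fp by blast
  hence "restrict (\<lambda>_. 0 :: rat) B T = restrict (\<lambda>_. 1) B T" by simp
  thus False by (simp add: BT)
qed

lemma torsion_quotient_not_tensor_rat_dim_1:
  fixes A B :: "'g::ab_group_add set"
  assumes A: "0 \<in> A" "\<And>x y. x \<in> A \<Longrightarrow> y \<in> A \<Longrightarrow> x + y \<in> A" "\<And>x. x \<in> A \<Longrightarrow> - x \<in> A"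
    and B: "0 \<in> B" "\<And>x y. x \<in> B \<Longrightarrow> y \<in> B \<Longrightarrow> x + y \<in> B" "\<And>x. x \<in> B \<Longrightarrow> - x \<in> B"
    and "B \<subseteq> A"
    and torsion: "\<And>x. x \<in> A \<Longrightarrow> \<exists>n>0. (\<Sum>j<(n::nat). x) \<in> B"
  shows "\<not> has_tensor_rat_dim (quotient_group A B) 1"
proof (rule torsion_imp_not_tensor_rat_dim_1)
  let ?G = "\<lparr>carrier = A, monoid.mult = (+), one = 0\<rparr>"
  have "group ?G"
    by (rule groupI) (use A in \<open>auto simp: add.assoc intro: exI[of _ "- _"] bexI[of _ "- _"]\<close>)
  then interpret G: comm_group ?G
    by (rule group.group_comm_groupI) (simp add: add.commute)
  have inv: "inv\<^bsub>?G\<^esub> x = - x" if "x \<in> A" for x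
    using that A by (intro G.inv_equality) auto
  have "subgroup B ?G"
    by (rule G.subgroupI) (use B \<open>B \<subseteq> A\<close> inv in \<open>auto simp: subset_iff\<close>)
  hence "B \<lhd> ?G" by (simp add: G.normal_iff_subgroup)
  then interpret N: normal B ?G .
  show "group (quotient_group A B)"
    unfolding quotient_group_def by (rule N.factorgroup_is_group)
  fix Y assume "Y \<in> carrier (quotient_group A B)"
  then obtain x where x: "x \<in> A" "Y = B #>\<^bsub>?G\<^esub> x"
    by (auto simp: quotient_group_def carrier_FactGroup)
  obtain n :: nat where n: "n > 0" "(\<Sum>j<n. x) \<in> B" using torsion x by blast
  have pow: "x [^]\<^bsub>?G\<^esub> n = (\<Sum>j<n. x)" for n :: nat
    by (induction n) (simp_all add: nat_pow_def)
  have "Y [^]\<^bsub>quotient_group A B\<^esub> n = B #>\<^bsub>?G\<^esub> (x [^]\<^bsub>?G\<^esub> n)"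
    unfolding quotient_group_def x(2) using x(1) by (simp add: N.FactGroup_pow)
  also have "\<dots> = B"
    unfolding pow using n(2) N.rcos_const[of "\<Sum>j<n. x"] by simp
  finally have "Y [^]\<^bsub>quotient_group A B\<^esub> n = \<one>\<^bsub>quotient_group A B\<^esub>"
    by (simp add: quotient_group_def)
  with n(1) show "\<exists>n>0. Y [^]\<^bsub>quotient_group A B\<^esub> (n::nat) = \<one>\<^bsub>quotient_group A B\<^esub>" by blast
qed


section \<open>Algebraic extensions and valuation transcendence\<close>

lemma ratfun_iff:
  assumes F: "subfield F (type_field :: 'c::field ring)"
  shows "f \<in> ratfun F \<longleftrightarrow>
    (\<exists>p q. poly_over F p \<and> poly_over F q \<and> q \<noteq> 0 \<and> f = to_fract p / to_fract q)"
proof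
  have constI: "\<exists>p q. poly_over F p \<and> poly_over F q \<and> q \<noteq> 0 \<and> to_fract r = to_fract p / to_fract q"
    if "poly_over F r" for r
    by (rule exI[of _ r], rule exI[of _ 1])
      (use that poly_over_const[OF F subfield_one[OF F]] in \<open>simp flip: one_pCons\<close>)
  note closed = poly_over_add[OF F] poly_over_mult[OF F] poly_over_uminus[OF F]
  assume "f \<in> ratfun F"
  thus "\<exists>p q. poly_over F p \<and> poly_over F q \<and> q \<noteq> 0 \<and> f = to_fract p / to_fract q"
    unfolding ratfun_def
  proof (induction rule: generate_field.induct)
    case one
    have "poly_over F 1"
      using poly_over_const[OF F subfield_one[OF F]] by (simp flip: one_pCons)
    from constI[OF this] show ?case unfolding to_fract_1 type_field_simps .
  next
    case (incl h)
    have "\<exists>r. poly_over F r \<and> h = to_fract r"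
      using incl poly_over_const[OF F] poly_over_pCons[OF F subfield_zero[OF F]
          poly_over_const[OF F subfield_one[OF F]]]
      by (auto simp: rf_const_eq rf_X_eq)
    thus ?case using constI by auto
  next
    case (a_inv h)
    then obtain p q where "poly_over F p" "poly_over F q" "q \<noteq> 0" "h = to_fract p / to_fract q"
      by blast
    thus ?case
      by (intro exI[of _ "- p"] exI[of _ q]) (auto simp: closed)
  next
    case (m_inv h)
    then obtain p q where "poly_over F p" "poly_over F q" "q \<noteq> 0" "h = to_fract p / to_fract q"
      by blast
    with m_inv(2) show ?case
      by (intro exI[of _ q] exI[of _ p]) auto
  next
    case (eng_add h h')
    obtain p q where "poly_over F p" "poly_over F q" "q \<noteq> 0" "h = to_fract p / to_fract q"
      using eng_add.IH(1) by blast
    moreover obtain p' q' where "poly_over F p'" "poly_over F q'" "q' \<noteq> 0" "h' = to_fract p' / to_fract q'"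
      using eng_add.IH(2) by blast
    ultimately show ?case
      by (intro exI[of _ "p * q' + p' * q"] exI[of _ "q * q'"])
        (auto simp: closed field_simps)
  next
    case (eng_mult h h')
    obtain p q where "poly_over F p" "poly_over F q" "q \<noteq> 0" "h = to_fract p / to_fract q"
      using eng_mult.IH(1) by blast
    moreover obtain p' q' where "poly_over F p'" "poly_over F q'" "q' \<noteq> 0" "h' = to_fract p' / to_fract q'"
      using eng_mult.IH(2) by blast
    ultimately show ?case
      by (intro exI[of _ "p * p'"] exI[of _ "q * q'"]) (auto simp: closed)
  qed
next
  let ?G = "generate_field type_field (rf_const ` F \<union> {rf_X})"
  have G: "subfield ?G type_field"
    by (rule field.generate_field_is_subfield[OF field_type_field]) simp
  have poly: "to_fract r \<in> ?G" if "poly_over F r" for r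
    using that
  proof (induction r)
    case 0
    thus ?case using subfield_zero[OF G] by simp
  next
    case (pCons c r)
    \<comment> \<open>Horner's scheme: the polynomial arises from constants and X by field
      operations.\<close>
    have eq: "to_fract (pCons c r) = rf_const c + rf_X * to_fract r"
      by (simp add: rf_const_eq rf_X_eq flip: to_fract_add to_fract_mult)
    have "c \<in> F" "poly_over F r"
      using pCons(3) by (auto simp: poly_over_def coeff_pCons split: nat.splits)
    hence "rf_const c \<in> ?G" "rf_X \<in> ?G" "to_fract r \<in> ?G"
      using pCons(2) by (auto intro: generate_field.incl)
    thus ?case
      unfolding eq by (intro subfield_add[OF G] subfield_mult[OF G])
  qed
  assume "\<exists>p q. poly_over F p \<and> poly_over F q \<and> q \<noteq> 0 \<and> f = to_fract p / to_fract q"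
  thus "f \<in> ratfun F"
    unfolding ratfun_def using poly subfield_divide[OF G] by blast
qed

lemma subfield_rf_const_image:
  assumes F: "subfield F (type_field :: 'c::field ring)"
  shows "subfield (rf_const ` F) type_field"
proof (rule field.subfieldI'[OF field_type_field])
  show "subring (rf_const ` F) type_field"
  proof (rule ring.subringI[OF ring_type_field])
    show "\<one>\<^bsub>type_field\<^esub> \<in> rf_const ` F"
      using imageI[OF subfield_one[OF F], of rf_const] by simp
  next
    fix h assume "h \<in> rf_const ` F"
    then obtain a where a: "a \<in> F" "h = rf_const a" by blast
    thus "\<ominus>\<^bsub>type_field\<^esub> h \<in> rf_const ` F"
      using imageI[OF subfield_uminus[OF F a(1)], of rf_const] by simp
    fix k assume "k \<in> rf_const ` F"
    then obtain b where b: "b \<in> F" "k = rf_const b" by blast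
    show "h \<otimes>\<^bsub>type_field\<^esub> k \<in> rf_const ` F" "h \<oplus>\<^bsub>type_field\<^esub> k \<in> rf_const ` F"
      using imageI[OF subfield_mult[OF F a(1) b(1)], of rf_const]
        imageI[OF subfield_add[OF F a(1) b(1)], of rf_const] a b by simp_all
  qed simp
next
  fix k assume "k \<in> rf_const ` F - {\<zero>\<^bsub>type_field\<^esub>}"
  then obtain a where a: "a \<in> F" "k = rf_const a" "k \<noteq> 0" by auto
  thus "inv\<^bsub>type_field\<^esub> k \<in> rf_const ` F"
    using imageI[OF subfield_inverse[OF F a(1)], of rf_const] by simp
qed

context krull_valuation
begin

lemma value_group_closed:
  assumes F: "subfield F type_field"
  shows "0 \<in> value_group v F"
    and "\<And>x y. x \<in> value_group v F \<Longrightarrow> y \<in> value_group v F \<Longrightarrow> x + y \<in> value_group v F"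
    and "\<And>x. x \<in> value_group v F \<Longrightarrow> - x \<in> value_group v F"
proof -
  show "0 \<in> value_group v F"
    using subfield_one[OF F] v_one unfolding value_group_def by blast
  show "x + y \<in> value_group v F" if "x \<in> value_group v F" "y \<in> value_group v F" for x y
  proof -
    from that obtain a b where "a \<in> F" "b \<in> F" "v a = Fin x" "v b = Fin y"
      by (auto simp: value_group_def)
    thus ?thesis
      using subfield_mult[OF F, of a b] by (auto simp: value_group_def v_mult intro!: bexI[of _ "a * b"])
  qed
  show "- x \<in> value_group v F" if "x \<in> value_group v F" for x
    using that subfield_inverse[OF F] v_inverse unfolding value_group_def by blast
qed

text \<open>In a vanishing sum of terms the minimal value is attained twice.\<close>

lemma algebraic_value_torsion:
  assumes F: "subfield F type_field" and p: "p \<noteq> 0" "poly_over F p" "poly p a = 0"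
    and a: "v a = Fin \<alpha>"
  shows "\<exists>n>0. (\<Sum>j<(n::nat). \<alpha>) \<in> value_group v F"
proof -
  define t where "t i = Polynomial.coeff p i * a ^ i" for i
  let ?D = "{..Polynomial.degree p}"
  have a0: "a \<noteq> 0" using a by auto
  define m where "m = Min ((v \<circ> t) ` ?D)"
  have "m \<in> (v \<circ> t) ` ?D" unfolding m_def by (rule Min_in) auto
  then obtain i where i: "i \<in> ?D" "v (t i) = m" by auto
  have le: "m \<le> v (t j)" if "j \<in> ?D" for j
    unfolding m_def using that by (intro Min_le) auto
  have "t (Polynomial.degree p) \<noteq> 0" using p(1) a0 by (simp add: t_def)
  hence "m \<noteq> Pinf" using le[of "Polynomial.degree p"] by auto
  then obtain \<mu> where \<mu>: "m = Fin \<mu>" using i not_Minf[of "t i"] by (cases m) auto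
  have "\<exists>j\<in>?D - {i}. v (t j) = m"
  proof (rule ccontr)
    assume "\<not> ?thesis"
    hence "Fin \<mu> < v (t j)" if "j \<in> ?D - {i}" for j
      using that le[of j] \<mu> by (auto simp: less_le)
    hence "Fin \<mu> < v (\<Sum>j\<in>?D - {i}. t j)" by (rule less_v_sum)
    hence "v (t i + (\<Sum>j\<in>?D - {i}. t j)) = Fin \<mu>"
      using v_add_eq_left[of "t i"] i \<mu> by simp
    moreover have "t i + (\<Sum>j\<in>?D - {i}. t j) = poly p a"
      unfolding poly_altdef t_def[symmetric] using i by (subst (2) sum.remove[of _ i]) auto
    ultimately show False using p(3) by simp
  qed
  then obtain j where j: "j \<noteq> i" "v (t j) = m" by auto
  have S: "(\<Sum>k<(x + y :: nat). \<alpha>) = (\<Sum>k<x. \<alpha>) + (\<Sum>k<y. \<alpha>)" for x y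
    by (induction y) (simp_all add: add.assoc)
  \<comment> \<open>Equality of the values of the terms with exponents x < y gives (y - x) \<alpha>
    = v(c) - v(d) for the two coefficients, which is the value of their quotient in F.\<close>
  have key: "\<exists>n>0. (\<Sum>k<(n::nat). \<alpha>) \<in> value_group v F"
    if "x < y" "v (t x) = m" "v (t y) = m" for x y
  proof -
    have nz: "Polynomial.coeff p x \<noteq> 0" "Polynomial.coeff p y \<noteq> 0"
      using that \<mu> by (auto simp: t_def)
    obtain c d where cd: "v (Polynomial.coeff p x) = Fin c" "v (Polynomial.coeff p y) = Fin d"
      using v_finite nz by metis
    have "c + (\<Sum>k<x. \<alpha>) = d + (\<Sum>k<y. \<alpha>)"
      using that \<mu> by (simp add: t_def v_mult v_power[OF a] cd)
    hence "(\<Sum>k<y - x. \<alpha>) = c - d"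
      using S[of x "y - x"] that(1) by (simp add: algebra_simps)
    moreover have "v (Polynomial.coeff p x / Polynomial.coeff p y) = Fin (c - d)"
      by (rule v_divide cd)+
    moreover have "Polynomial.coeff p x / Polynomial.coeff p y \<in> F"
      using p(2) by (intro subfield_divide[OF F]) (auto simp: poly_over_def)
    ultimately have "(\<Sum>k<y - x. \<alpha>) \<in> value_group v F"
      unfolding value_group_def by (intro CollectI bexI) simp_all
    with that(1) show ?thesis by (intro exI[of _ "y - x"]) auto
  qed
  from j i key[of i j] key[of j i] show ?thesis by (meson nat_neq_iff)
qed

lemma ring_residue_class_ring: "Ring.ring (residue_class_ring type_field v)"
  unfolding residue_class_ring_def by (rule ideal.quotient_is_ring[OF ideal_valuation_ideal])

text \<open>Dividing the equation by a coefficient of least value makes it integral with one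
  coefficient equal to 1, so its reduction is a nonzero equation for the residue of a. The set E is
  kept general because the transcendence basis refers to a generated field.\<close>

lemma algebraic_residue:
  assumes F: "subfield F type_field" and p: "p \<noteq> 0" "poly_over F p" "poly p a = 0"
    and a: "0 \<le> v a" and E: "residue_field type_field v F \<subseteq> E"
  shows "\<not> ring.transcendental (residue_class_ring type_field v) E (res a)"
proof -
  let ?O = "valuation_ring type_field v" and ?R = "residue_class_ring type_field v"
  interpret I: ideal "valuation_ideal type_field v" ?O by (rule ideal_valuation_ideal)
  interpret R: Ring.ring ?R by (rule ring_residue_class_ring)
  interpret h: ring_hom_ring ?O ?R "\<lambda>x. res x"
    unfolding residue_class_ring_def by (rule I.rcos_ring_hom_ring)
  have sub: "subring {x. 0 \<le> v x} type_field"
    using Fin_add_le_v_mult[of 0 _ 0]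
    by (intro ring.subringI ring_type_field) (auto simp: zero_extended_def le_v_add)
  define \<mu> where "\<mu> = Min (v ` set (coeffs p))"
  have "\<mu> \<in> v ` set (coeffs p)"
    unfolding \<mu>_def using p(1) by (intro Min_in) auto
  then obtain c where c: "c \<in> set (coeffs p)" "v c = \<mu>" by auto
  have le: "\<mu> \<le> v d" if "d \<in> set (coeffs p)" for d
    unfolding \<mu>_def using that by (intro Min_le) auto
  have coeffs_F: "set (coeffs p) \<subseteq> F" using p(2) by (auto simp: poly_over_def coeffs_def)
  have c0: "c \<noteq> 0"
  proof
    assume "c = 0"
    hence "v d = Pinf" if "d \<in> set (coeffs p)" for d using le[OF that] c by simp
    moreover have "Polynomial.lead_coeff p \<in> set (coeffs p)"
      using p(1) by (auto simp: coeffs_def)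
    ultimately show False using p(1) by (metis eq_Pinf_iff leading_coeff_0_iff)
  qed
  obtain \<gamma> where \<gamma>: "v c = Fin \<gamma>" using c0 v_finite by blast
  define l where "l = map (\<lambda>d. d / c) (rev (coeffs p))"
  have l_val: "0 \<le> v d \<and> d \<in> F" if "d \<in> set l" for d
  proof -
    from that obtain e where e: "e \<in> set (coeffs p)" "d = e / c" by (auto simp: l_def)
    have "Fin (\<gamma> + - \<gamma>) \<le> v (e * inverse c)"
      using le[OF e(1)] c \<gamma> v_inverse[OF \<gamma>] by (intro Fin_add_le_v_mult) auto
    moreover have "d \<in> F" using e c coeffs_F subfield_divide[OF F] by auto
    ultimately show ?thesis using e(2) by (simp add: divide_inverse zero_extended_def)
  qed
  hence l_carr: "set l \<subseteq> carrier ?O" by (auto simp: valuation_ring_simps)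
  have a_carr: "a \<in> carrier ?O" using a by (simp add: valuation_ring_simps)
  have "ring.eval ?O l a = ring.eval type_field l a"
    unfolding valuation_ring_def using ring.eval_consistent[OF ring_type_field sub] by simp
  also have "\<dots> = poly (smult (inverse c) p) a"
  proof -
    have "Poly (rev l) = smult (inverse c) p"
      by (rule poly_eqI)
        (simp add: l_def rev_map nth_default_map_eq[where dflt' = 0] nth_default_coeffs_eq
          divide_inverse mult.commute)
    thus ?thesis by (simp add: eval_type_field)
  qed
  finally have "R.eval (map (\<lambda>x. res x) l) (res a) = \<zero>\<^bsub>?R\<^esub>"
    using h.eval_hom'[OF a_carr l_carr] p(3) h.hom_zero by (simp add: valuation_ring_simps)
  moreover have res_carr: "set (map (\<lambda>x. res x) l) \<subseteq> carrier ?R" "res a \<in> carrier ?R"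
    using l_carr a_carr h.hom_closed by auto
  \<comment> \<open>Reduction may kill leading coefficients, and polynomials are lists without
    leading zeros; normalizing leaves the evaluation unchanged.\<close>
  ultimately have ev: "R.eval (R.normalize (map (\<lambda>x. res x) l)) (res a) = \<zero>\<^bsub>?R\<^esub>"
    by (simp only: R.eval_normalize)
  have "set (map (\<lambda>x. res x) l) \<subseteq> E"
    using E l_val by (auto simp: residue_field_def)
  hence carr: "R.normalize (map (\<lambda>x. res x) l) \<in> carrier (univ_poly ?R E)"
    using R.normalize_gives_polynomial by (simp add: univ_poly_carrier[symmetric])
  have normalize_Nil: "R.normalize k = [] \<Longrightarrow> set k \<subseteq> {\<zero>\<^bsub>?R\<^esub>}" for k
    by (induction k) (auto split: if_splits)
  \<comment> \<open>The coefficient c divided by itself; its residue is nonzero, so normalizing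
    cannot empty the list.\<close>
  have "1 \<in> set l" using c(1) c0 by (auto simp: l_def intro!: image_eqI[of _ _ c])
  hence "res 1 \<in> set (map (\<lambda>x. res x) l)" by simp
  moreover have "res 1 \<noteq> \<zero>\<^bsub>?R\<^esub>"
    using res_eq_iff[of 1 0] h.hom_zero by (simp add: valuation_ring_simps zero_extended_def)
  ultimately have "R.normalize (map (\<lambda>x. res x) l) \<noteq> []"
    using normalize_Nil by blast
  from R.algebraicI[OF carr this ev] show ?thesis by (simp add: over_def)
qed

end

lemma poly_map_rf_const: "poly (map_poly rf_const p) (rf_const a) = rf_const (poly p a)"
  by (induction p) (simp_all add: map_poly_pCons)

text \<open>The torsion and residue lemmas live in the valued field of rational functions, so an
  equation for a constant is moved there.\<close>

lemma algebraic_rf_const: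
  assumes "p \<noteq> 0" "poly_over F p" "poly p a = 0"
  shows "map_poly rf_const p \<noteq> 0" "poly_over (rf_const ` F) (map_poly rf_const p)"
    "poly (map_poly rf_const p) (rf_const a) = 0"
  using assms
  by (auto simp: poly_over_def coeff_map_poly poly_map_rf_const map_poly_eq_0_iff)

text \<open>
  If the values of \<open>X - a\<close> have no maximum, every rational function is close to a constant, so
  the value group and the residue field are those of the algebraically closed constant field.
\<close>

locale no_max = krull_valuation v
  for v :: "'c::alg_closed_field poly fract \<Rightarrow> 'g::linordered_ab_group_add extended" +
  assumes no_max: "\<And>a. \<exists>b. v (rf_X - rf_const a) < v (rf_X - rf_const b)"
begin

text \<open>Induction on linear factors. The claim is stated for all b beyond a threshold a, since
  thresholds for several factors combine to the larger one.\<close>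

lemma poly_near_const:
  "p \<noteq> 0 \<Longrightarrow> \<exists>a. \<forall>b. v (rf_X - rf_const a) \<le> v (rf_X - rf_const b) \<longrightarrow>
    near (to_fract p) (rf_const (poly p b))"
proof (induction "Polynomial.degree p" arbitrary: p)
  case 0
  then obtain c where "p = [:c:]" by (metis degree_eq_zeroE)
  with 0 show ?case by (simp add: rf_const_eq near_refl)
next
  case (Suc n)
  then obtain b0 where "poly p b0 = 0" using alg_closed_imp_poly_has_root[of p] by auto
  then obtain q where q: "p = [:- b0, 1:] * q" by (auto simp: poly_eq_0_iff_dvd)
  with Suc(3) have q0: "q \<noteq> 0" by auto
  hence "Polynomial.degree p = Suc (Polynomial.degree q)"
    unfolding q by (subst degree_mult_eq) auto
  with Suc(2) have "n = Polynomial.degree q" by simp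
  from Suc(1)[OF this q0] obtain a where
    a: "v (rf_X - rf_const a) \<le> v (rf_X - rf_const b) \<Longrightarrow> near (to_fract q) (rf_const (poly q b))"
    for b by blast
  obtain a' where a': "v (rf_X - rf_const b0) < v (rf_X - rf_const a')" using no_max by blast
  have "near (to_fract p) (rf_const (poly p b))"
    if b: "max (v (rf_X - rf_const a)) (v (rf_X - rf_const a')) \<le> v (rf_X - rf_const b)" for b
  proof -
    \<comment> \<open>The difference of X - b0 and b - b0 is X - b, whose value exceeds v(X - b0) by
      the choice of a'.\<close>
    have "near (rf_X - rf_const b0) (rf_const (b - b0))"
      using b a' by (auto simp: near_def intro: less_le_trans)
    from near_mult[OF this a[of b]] b show ?thesis
      unfolding q to_fract_mult to_fract_linear by (simp add: poly_mult algebra_simps)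
  qed
  thus ?case by (cases "v (rf_X - rf_const a) \<le> v (rf_X - rf_const a')") (auto simp: max_def)
qed

lemma near_const:
  assumes "f \<noteq> 0"
  shows "\<exists>c\<in>range rf_const. near f c"
proof -
  obtain p q where f: "f = Fract p q" "q \<noteq> 0" "p \<noteq> 0"
    using assms by (cases f rule: Fract_cases_nonzero) auto
  obtain a where a: "\<And>b. v (rf_X - rf_const a) \<le> v (rf_X - rf_const b) \<Longrightarrow>
      near (to_fract p) (rf_const (poly p b))" using poly_near_const f(3) by blast
  obtain a' where a': "\<And>b. v (rf_X - rf_const a') \<le> v (rf_X - rf_const b) \<Longrightarrow>
      near (to_fract q) (rf_const (poly q b))" using poly_near_const f(2) by blast
  obtain b where b: "v (rf_X - rf_const a) \<le> v (rf_X - rf_const b)"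
    "v (rf_X - rf_const a') \<le> v (rf_X - rf_const b)" by (meson linear order_refl)
  have "near f (rf_const (poly p b) / rf_const (poly q b))"
    unfolding f Fract_conv_to_fract by (intro near_divide a a' b)
  also have "rf_const (poly p b) / rf_const (poly q b) = rf_const (poly p b / poly q b)"
    by (simp add: divide_inverse)
  finally show ?thesis by blast
qed

text \<open>All values and residues come from constants, which are algebraic over F. So the value
  group quotient is torsion, and the single element of a transcendence basis would be the residue of
  an algebraic constant.\<close>

lemma not_valuation_transcendental:
  assumes F: "subfield F type_field" and alg: "algebraic_closure_of F = UNIV"
  shows "\<not> valuation_transcendental v F"
proof -
  have zero: "0 \<in> range rf_const" by (auto intro: image_eqI[of _ _ 0])
  note imm = immediate_extension_near[OF subset_UNIV _ zero]
  have vg: "value_group v (range rf_const) = value_group v UNIV"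
    and rf: "residue_field type_field v (range rf_const) = residue_field type_field v UNIV"
    using imm near_const by blast+
  note Fc = subfield_rf_const_image[OF F]
  have G: "subfield (ratfun F) type_field"
    unfolding ratfun_def by (rule field.generate_field_is_subfield[OF field_type_field]) simp
  have "\<not> value_transcendental v F"
    unfolding value_transcendental_def
  proof (rule torsion_quotient_not_tensor_rat_dim_1)
    show "value_group v (rf_const ` F) \<subseteq> value_group v (ratfun F)"
      by (auto simp: value_group_def ratfun_def intro: generate_field.incl)
    fix \<alpha> assume "\<alpha> \<in> value_group v (ratfun F)"
    hence "\<alpha> \<in> value_group v (range rf_const)" unfolding vg by (auto simp: value_group_def)
    then obtain c where c: "v (rf_const c) = Fin \<alpha>" by (auto simp: value_group_def)
    obtain p where "p \<noteq> 0" "poly_over F p" "poly p c = 0"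
      using algebraic_closure_of_iff[OF F, of c] alg by auto
    from algebraic_value_torsion[OF Fc algebraic_rf_const[OF this] c]
    show "\<exists>n>0. (\<Sum>j<(n::nat). \<alpha>) \<in> value_group v (rf_const ` F)" .
  qed (use value_group_closed[OF Fc] value_group_closed[OF G] in auto)
  moreover have "\<not> residue_transcendental v F"
  proof
    assume "residue_transcendental v F"
    then obtain B where "card B = 1" and B: "transcendence_basis (residue_class_ring type_field v)
       (residue_field type_field v (rf_const ` F)) (residue_field type_field v (ratfun F)) B"
      by (auto simp: residue_transcendental_def has_trdeg_def)
    then obtain t where t: "B = {t}" by (auto simp: card_1_singleton_iff)
    let ?E = "generate_field (residue_class_ring type_field v) (residue_field type_field v (rf_const ` F))"
    have trans: "ring.transcendental (residue_class_ring type_field v) ?E t"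
      using B t by (simp add: transcendence_basis_def)
    have "t \<in> residue_field type_field v (range rf_const)"
      using B t unfolding rf by (auto simp: transcendence_basis_def residue_field_def)
    then obtain c where c: "0 \<le> v (rf_const c)" "t = res (rf_const c)"
      by (auto simp: residue_field_def)
    obtain p where "p \<noteq> 0" "poly_over F p" "poly p c = 0"
      using algebraic_closure_of_iff[OF F, of c] alg by auto
    from algebraic_residue[OF Fc algebraic_rf_const[OF this] c(1), of ?E] trans c(2)
    show False by (auto intro: generate_field.incl)
  qed
  ultimately show ?thesis by (simp add: valuation_transcendental_def)
qed

end


section \<open>Density and continuity of roots\<close>

lemma subfield_ratfun: "subfield (ratfun F) type_field"
  unfolding ratfun_def by (rule field.generate_field_is_subfield[OF field_type_field]) simp

lemma rf_X_in_ratfun: "rf_X \<in> ratfun F"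
  by (auto simp: ratfun_def intro: generate_field.incl)

lemma rf_const_in_ratfun: "c \<in> F \<Longrightarrow> rf_const c \<in> ratfun F"
  by (auto simp: ratfun_def intro: generate_field.incl)

lemma to_fract_in_ratfun:
  assumes "subfield F (type_field :: 'c::field ring)" "poly_over F p"
  shows "to_fract p \<in> ratfun F"
proof -
  have "poly_over F 1"
    using poly_over_const[OF assms(1) subfield_one[OF assms(1)]] by (simp flip: one_pCons)
  thus ?thesis
    unfolding ratfun_iff[OF assms(1)] using assms(2)
    by (intro exI[of _ p] exI[of _ 1]) simp
qed

text \<open>
  Up to a unit, \<open>g b\<close> is the product of \<open>b - \<beta>\<close> over the roots \<open>\<beta>\<close> of \<open>g\<close>, so a large value of \<open>g b\<close>
  forces a large value of one factor.
\<close>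

lemma (in krull_valuation) root_near:
  fixes g :: "'f poly"
  assumes root: "\<And>p :: 'f poly. Polynomial.degree p > 0 \<Longrightarrow> \<exists>x. poly p x = 0"
  assumes "v (Polynomial.lead_coeff g) = Fin 0" "Fin (\<Sum>j<Polynomial.degree g. \<gamma>) < v (poly g b)"
  shows "\<exists>\<beta>. poly g \<beta> = 0 \<and> Fin \<gamma> \<le> v (b - \<beta>)"
  using assms(2,3)
proof (induction "Polynomial.degree g" arbitrary: g)
  case 0
  then obtain c where "g = [:c:]" by (metis degree_eq_zeroE)
  with 0 show ?case by simp
next
  case (Suc n)
  then obtain \<beta> where \<beta>: "poly g \<beta> = 0" using root[of g] by auto
  then obtain h where h: "g = [:- \<beta>, 1:] * h" by (auto simp: poly_eq_0_iff_dvd)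
  with Suc(2) have "h \<noteq> 0" by auto
  hence deg: "Polynomial.degree g = Suc (Polynomial.degree h)"
    unfolding h by (subst degree_mult_eq) auto
  with Suc(2) have n: "n = Polynomial.degree h" by simp
  have lc: "v (Polynomial.lead_coeff h) = Fin 0"
    using Suc(3) unfolding h by (simp add: lead_coeff_mult del: mult_pCons_left)
  show ?case
  proof (cases "Fin \<gamma> \<le> v (b - \<beta>)")
    case True
    with \<beta> show ?thesis by blast
  next
    case False
    have "poly g b = (b - \<beta>) * poly h b" by (simp add: h algebra_simps)
    hence *: "Fin ((\<Sum>j<n. \<gamma>) + \<gamma>) < v (b - \<beta>) + v (poly h b)"
      using Suc(4) unfolding deg n by (simp add: v_mult)
    \<comment> \<open>With v(b - \<beta>) < \<gamma>, a value of at most n \<gamma> for h(b) would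
      leave g(b) below (n + 1) \<gamma>.\<close>
    have "Fin (\<Sum>j<n. \<gamma>) < v (poly h b)"
    proof (rule ccontr)
      assume "\<not> ?thesis"
      moreover from False obtain x where x: "v (b - \<beta>) = Fin x" "x < \<gamma>"
        using not_Minf[of "b - \<beta>"] by (cases "v (b - \<beta>)") auto
      ultimately obtain y where y: "v (poly h b) = Fin y" "y \<le> (\<Sum>j<n. \<gamma>)"
        using not_Minf[of "poly h b"] by (cases "v (poly h b)") auto
      have "x + y < \<gamma> + (\<Sum>j<n. \<gamma>)" using x(2) y(2) by (rule add_less_le_mono)
      with * x(1) y(1) show False by (simp add: add.commute)
    qed
    with Suc(1)[OF n lc] n obtain \<beta>' where "poly h \<beta>' = 0" "Fin \<gamma> \<le> v (b - \<beta>')" by auto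
    thus ?thesis by (intro exI[of _ \<beta>']) (simp add: h)
  qed
qed

lemma poly_eq_sum_le:
  "Polynomial.degree p \<le> n \<Longrightarrow> poly p (x :: 'a::comm_semiring_1) = (\<Sum>i\<le>n. Polynomial.coeff p i * x ^ i)"
  unfolding poly_altdef by (intro sum.mono_neutral_left) (auto simp: coeff_eq_0)

locale dense_valued_fields = krull_valuation v
  for v :: "'c::alg_closed_field poly fract \<Rightarrow> 'g::linordered_ab_group_add extended" +
  fixes K Kh :: "'c set"
  assumes K: "subfield K type_field" and Kh: "subfield Kh type_field" and K_sub: "K \<subseteq> Kh"
    and Kh_alg: "algebraic_closure_of Kh = UNIV"
    and dense: "\<And>a \<gamma>. a \<in> Kh \<Longrightarrow> \<gamma> \<in> value_group v (rf_const ` Kh) \<Longrightarrow>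
      \<exists>b\<in>K. Fin \<gamma> < v (rf_const (a - b))"
    and cofinal: "\<And>\<gamma>. \<gamma> \<in> value_group v (ratfun Kh) \<Longrightarrow> \<exists>\<delta>\<in>value_group v (rf_const ` Kh). \<gamma> \<le> \<delta>"
begin

sublocale U: krull_valuation "v \<circ> rf_const"
  using krull_valuation_axioms by (rule krull_valuation_const)

text \<open>The precisions reachable by approximation from K. Unlike membership in the value group
  of \<open>Kh\<close>, this property passes to smaller elements, and with sums and
  \<open>bdd_multiple\<close> it reaches all values of constants.\<close>

definition bdd :: "'g \<Rightarrow> bool" where
  "bdd \<gamma> \<longleftrightarrow> (\<exists>\<delta>\<in>value_group v (rf_const ` Kh). \<gamma> \<le> \<delta>)"

lemmas value_group_Kh_closed = value_group_closed[OF subfield_rf_const_image[OF Kh]]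

lemma bdd_mono: "bdd \<delta> \<Longrightarrow> \<gamma> \<le> \<delta> \<Longrightarrow> bdd \<gamma>"
  unfolding bdd_def by (meson order_trans)

lemma bdd_zero: "bdd 0"
  unfolding bdd_def using value_group_Kh_closed(1) by blast

lemma bdd_add: "bdd \<gamma> \<Longrightarrow> bdd \<delta> \<Longrightarrow> bdd (\<gamma> + \<delta>)"
  unfolding bdd_def using value_group_Kh_closed(2) by (meson add_mono)

lemma bdd_sum: "bdd \<gamma> \<Longrightarrow> bdd (\<Sum>j<(n::nat). \<gamma>)"
  by (induction n) (auto intro: bdd_zero bdd_add)

lemma bdd_max: "bdd \<gamma> \<Longrightarrow> bdd \<delta> \<Longrightarrow> bdd (max \<gamma> \<delta>)"
  by (simp add: max_def)

text \<open>A nonnegative \<gamma> lies below n \<gamma>, a negative one below the value 0.\<close>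

lemma bdd_multiple:
  assumes "bdd (\<Sum>j<(n::nat). \<gamma>)" "n > 0"
  shows "bdd \<gamma>"
proof (cases "0 \<le> \<gamma>")
  case True
  obtain m where m: "n = Suc m" using assms(2) by (cases n) auto
  have "\<gamma> \<le> (\<Sum>j<n. \<gamma>)" unfolding m using True by (simp add: sum_nonneg)
  with assms(1) show ?thesis by (rule bdd_mono)
qed (use bdd_mono[OF bdd_zero] in auto)

lemma bdd_ratfun: "f \<in> ratfun Kh \<Longrightarrow> v f = Fin \<gamma> \<Longrightarrow> bdd \<gamma>"
  using cofinal unfolding bdd_def value_group_def by blast

lemma algebraic_Kh: obtains p where "p \<noteq> 0" "poly_over Kh p" "poly p a = 0"
  using algebraic_closure_of_iff[OF Kh, of a] Kh_alg by auto

lemma bdd_const: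
  assumes "v (rf_const c) = Fin \<gamma>"
  shows "bdd \<gamma>"
proof -
  obtain p where "p \<noteq> 0" "poly_over Kh p" "poly p c = 0" by (rule algebraic_Kh)
  from algebraic_value_torsion[OF subfield_rf_const_image[OF Kh] algebraic_rf_const[OF this] assms]
  obtain n :: nat where "n > 0" "(\<Sum>j<n. \<gamma>) \<in> value_group v (rf_const ` Kh)" by blast
  thus ?thesis by (intro bdd_multiple[of \<gamma> n]) (auto simp: bdd_def)
qed

lemma bdd_uminus_const: "v (rf_const c) = Fin \<gamma> \<Longrightarrow> bdd (- \<gamma>)"
  using bdd_const[of "inverse c" "- \<gamma>"] v_inverse by simp

lemma approx:
  assumes "a \<in> Kh" "bdd \<gamma>"
  shows "\<exists>b\<in>K. Fin \<gamma> < v (rf_const (a - b))"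
proof -
  obtain \<delta> where "\<delta> \<in> value_group v (rf_const ` Kh)" "\<gamma> \<le> \<delta>" using assms(2) by (auto simp: bdd_def)
  moreover from dense[OF assms(1) this(1)] obtain b where "b \<in> K" "Fin \<delta> < v (rf_const (a - b))" by blast
  ultimately show ?thesis by (intro bexI[of _ b]) (auto simp del: rf_const_simps intro: le_less_trans[of _ "Fin \<delta>"])
qed

text \<open>The precision may vary with the index, because coefficients are later weighted by powers
  of X or of a root.\<close>

lemma poly_approx:
  assumes p: "poly_over Kh p" and N: "\<And>i. bdd (N i)"
  obtains q where "poly_over K q" "Polynomial.degree q \<le> Polynomial.degree p"
    "\<And>i. Fin (N i) < v (rf_const (Polynomial.coeff p i - Polynomial.coeff q i))"
proof -
  have "\<forall>i. \<exists>b\<in>K. Fin (N i) < v (rf_const (Polynomial.coeff p i - b))"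
    using approx N p by (auto simp: poly_over_def)
  then obtain b where b: "\<And>i. b i \<in> K" "\<And>i. Fin (N i) < v (rf_const (Polynomial.coeff p i - b i))"
    by metis
  define q where "q = (\<Sum>i\<le>Polynomial.degree p. Polynomial.monom (b i) i)"
  have coeff: "Polynomial.coeff q i = (if i \<le> Polynomial.degree p then b i else 0)" for i
    by (auto simp: q_def coeff_sum sum.delta)
  show ?thesis
  proof
    show "poly_over K q" using b subfield_zero[OF K] by (simp add: poly_over_def coeff)
    show "Polynomial.degree q \<le> Polynomial.degree p" by (rule degree_le) (simp add: coeff)
    show "Fin (N i) < v (rf_const (Polynomial.coeff p i - Polynomial.coeff q i))" for i
      using b(2)[of i] by (auto simp: coeff coeff_eq_0 simp del: rf_const_simps(4))
  qed
qed

lemma to_fract_near: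
  assumes p: "poly_over Kh p" "p \<noteq> 0"
  shows "\<exists>q. poly_over K q \<and> near (to_fract p) (to_fract q)"
proof -
  obtain \<pi> where \<pi>: "v (to_fract p) = Fin \<pi>" using p(2) v_finite by (metis to_fract_eq_0_iff)
  have "rf_X \<noteq> (0 :: 'c poly fract)" using rf_X_minus_const_nonzero[of 0] by simp
  then obtain \<xi> where \<xi>: "v rf_X = Fin \<xi>" using v_finite by blast
  have "bdd (- \<xi>)"
    using bdd_ratfun[OF subfield_inverse[OF subfield_ratfun rf_X_in_ratfun] v_inverse[OF \<xi>]] .
  \<comment> \<open>With \<xi> = v(X), precision \<pi> - i \<xi> at index i leaves every term of p -
    q with value above \<pi> = v(p).\<close>
  hence "bdd (\<pi> + (\<Sum>j<i. - \<xi>))" for i :: nat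
    using bdd_ratfun[OF to_fract_in_ratfun[OF Kh p(1)] \<pi>] bdd_sum bdd_add by blast
  then obtain q where q: "poly_over K q"
    "\<And>i. Fin (\<pi> + (\<Sum>j<i. - \<xi>)) < v (rf_const (Polynomial.coeff p i - Polynomial.coeff q i))"
    using poly_approx[OF p(1), of "\<lambda>i. \<pi> + (\<Sum>j<i. - \<xi>)"] by metis
  let ?r = "p - q"
  have "to_fract ?r = (\<Sum>i\<le>Polynomial.degree ?r. rf_const (Polynomial.coeff ?r i) * rf_X ^ i)"
    using to_fract_pcompose_linear[of "Polynomial.coeff ?r" "Polynomial.degree ?r" 0]
    unfolding poly_as_sum_of_monoms by simp
  also have "Fin \<pi> < v \<dots>"
  proof (rule less_v_sum)
    fix i
    have "Fin (\<pi> + (\<Sum>j<i. - \<xi>) + (\<Sum>j<i. \<xi>)) < v (rf_const (Polynomial.coeff ?r i) * rf_X ^ i)"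
      using q(2)[of i] v_power[OF \<xi>] by (intro Fin_add_less_v_mult) auto
    thus "Fin \<pi> < v (rf_const (Polynomial.coeff ?r i) * rf_X ^ i)"
      by (simp add: sum_negf)
  qed
  finally show ?thesis using q(1) \<pi> by (auto simp: near_def)
qed

text \<open>Quotients of near elements are near, so it suffices to approximate numerator and
  denominator.\<close>

lemma immediate_ratfun:
  "value_group v (ratfun K) = value_group v (ratfun Kh)"
  "residue_field type_field v (ratfun K) = residue_field type_field v (ratfun Kh)"
proof -
  have sub: "ratfun K \<subseteq> ratfun Kh"
    unfolding ratfun_def by (rule field.mono_generate_field[OF field_type_field]) (use K_sub in auto)
  have zero: "0 \<in> ratfun K" by (rule subfield_zero[OF subfield_ratfun])
  have near: "\<exists>y\<in>ratfun K. near x y" if x: "x \<in> ratfun Kh" "x \<noteq> 0" for x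
  proof -
    obtain p q where pq: "poly_over Kh p" "poly_over Kh q" "q \<noteq> 0" "x = to_fract p / to_fract q"
      using x ratfun_iff[OF Kh] by blast
    with x have "p \<noteq> 0" by auto
    obtain p' where p': "poly_over K p'" "near (to_fract p) (to_fract p')"
      using to_fract_near[OF pq(1) \<open>p \<noteq> 0\<close>] by blast
    obtain q' where q': "poly_over K q'" "near (to_fract q) (to_fract q')"
      using to_fract_near[OF pq(2,3)] by blast
    have "near x (to_fract p' / to_fract q')" unfolding pq(4) by (intro near_divide p' q')
    moreover have "to_fract p' / to_fract q' \<in> ratfun K"
      by (intro subfield_divide[OF subfield_ratfun] to_fract_in_ratfun K p' q')
    ultimately show ?thesis by blast
  qed
  show "value_group v (ratfun K) = value_group v (ratfun Kh)"
    "residue_field type_field v (ratfun K) = residue_field type_field v (ratfun Kh)"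
    by (rule immediate_extension_near[OF sub _ zero], rule near, assumption+)+
qed

lemma immediate_const:
  "value_group v (rf_const ` K) = value_group v (rf_const ` Kh)"
  "residue_field type_field v (rf_const ` K) = residue_field type_field v (rf_const ` Kh)"
proof -
  have sub: "rf_const ` K \<subseteq> rf_const ` Kh" using K_sub by auto
  have zero: "0 \<in> rf_const ` K" by (rule subfield_zero[OF subfield_rf_const_image[OF K]])
  have near: "\<exists>y\<in>rf_const ` K. near x y" if x: "x \<in> rf_const ` Kh" "x \<noteq> 0" for x
  proof -
    obtain a where a: "a \<in> Kh" "x = rf_const a" using x by auto
    from x(2) obtain \<alpha> where \<alpha>: "v (rf_const a) = Fin \<alpha>" unfolding a(2) by (rule v_finite)
    obtain b where "b \<in> K" "Fin \<alpha> < v (rf_const (a - b))"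
      using approx[OF a(1) bdd_const[OF \<alpha>]] by blast
    thus ?thesis using a \<alpha> by (auto simp: near_def)
  qed
  show "value_group v (rf_const ` K) = value_group v (rf_const ` Kh)"
    "residue_field type_field v (rf_const ` K) = residue_field type_field v (rf_const ` Kh)"
    by (rule immediate_extension_near[OF sub _ zero], rule near, assumption+)+
qed

lemma valuation_transcendental_iff: "valuation_transcendental v K \<longleftrightarrow> valuation_transcendental v Kh"
  unfolding valuation_transcendental_def value_transcendental_def residue_transcendental_def
    immediate_ratfun immediate_const ..

text \<open>As f(b) = 0, the value of g(b) is that of (f - g)(b); once it exceeds n \<gamma> for n =
  deg f, \<open>root_near\<close> yields a root of g close to b. The precision N is fixed before g,
  as it must serve both approximations over K and separable perturbations.\<close>

lemma root_continuity:
  assumes f: "Polynomial.lead_coeff f = 1" "poly f b = 0" and \<gamma>: "bdd \<gamma>"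
  shows "\<exists>N. (\<forall>i. bdd (N i)) \<and> (\<forall>g. Polynomial.degree g \<le> Polynomial.degree f \<longrightarrow>
       (\<forall>i\<le>Polynomial.degree f.
          Fin (N i) < v (rf_const (Polynomial.coeff f i - Polynomial.coeff g i))) \<longrightarrow>
       Polynomial.degree g = Polynomial.degree f \<and>
       (\<exists>\<beta>. poly g \<beta> = 0 \<and> Fin \<gamma> \<le> v (rf_const (b - \<beta>))))"
proof -
  let ?n = "Polynomial.degree f"
  have "\<exists>\<beta>. Fin \<beta> \<le> v (rf_const (b ^ i)) \<and> bdd (- \<beta>)" for i
  proof (cases "b ^ i = 0")
    case True
    thus ?thesis unfolding True using bdd_zero by (intro exI[of _ 0]) simp
  next
    case False
    then obtain \<beta> where "v (rf_const (b ^ i)) = Fin \<beta>" using v_finite rf_const_eq_0_iff by metis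
    thus ?thesis using bdd_uminus_const[of "b ^ i" \<beta>] by (intro exI[of _ \<beta>]) simp
  qed
  then obtain \<beta> where \<beta>: "\<And>i. Fin (\<beta> i) \<le> v (rf_const (b ^ i))" "\<And>i. bdd (- \<beta> i)" by metis
  \<comment> \<open>The bound 0 brings the leading coefficient of g close to 1, so the degree is
    kept and \<open>root_near\<close> applies; the other bound lifts the term with b^i above n
    \<gamma>. Here \<beta> i bounds v(b^i) from below and is 0 when b^i vanishes.\<close>
  define N where "N i = max 0 ((\<Sum>j<?n. \<gamma>) + - \<beta> i)" for i
  show ?thesis
  proof (intro exI[of _ N] conjI allI impI)
    show "bdd (N i)" for i
      unfolding N_def by (intro bdd_max bdd_zero bdd_add bdd_sum \<gamma> \<beta>)
  next
    fix g assume deg: "Polynomial.degree g \<le> ?n"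
      and "\<forall>i\<le>?n. Fin (N i) < v (rf_const (Polynomial.coeff f i - Polynomial.coeff g i))"
    hence close: "Fin (N i) < v (rf_const (Polynomial.coeff f i - Polynomial.coeff g i))"
      if "i \<le> ?n" for i using that by blast
    have "Fin 0 < v (rf_const (1 - Polynomial.coeff g ?n))"
      using close[of ?n] f(1) by (auto simp: N_def intro: le_less_trans[of _ "Fin (N ?n)"])
    hence "near 1 (rf_const (Polynomial.coeff g ?n))" by (simp add: near_def)
    from near_v_eq[OF this] have lc: "v (rf_const (Polynomial.coeff g ?n)) = Fin 0" by simp
    hence "Polynomial.coeff g ?n \<noteq> 0" by auto
    hence deg_eq: "Polynomial.degree g = ?n" using deg le_degree by (intro antisym)
    have "Fin (\<Sum>j<?n. \<gamma>) < v (rf_const (poly g b))"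
    proof -
      have "Polynomial.degree (f - g) \<le> ?n" using deg by (intro degree_diff_le) auto
      hence "rf_const (poly (f - g) b) = (\<Sum>i\<le>?n. rf_const (Polynomial.coeff (f - g) i) * rf_const (b ^ i))"
        using poly_eq_sum_le[of "f - g" ?n b] by simp
      also have "Fin (\<Sum>j<?n. \<gamma>) < v \<dots>"
      proof (rule less_v_sum)
        fix i assume "i \<in> {..?n}"
        hence "Fin (((\<Sum>j<?n. \<gamma>) + - \<beta> i) + \<beta> i) <
            v (rf_const (Polynomial.coeff (f - g) i) * rf_const (b ^ i))"
          using close[of i] \<beta>(1)[of i]
          by (intro Fin_add_less_v_mult) (auto simp: N_def intro: le_less_trans[of _ "Fin (N i)"])
        thus "Fin (\<Sum>j<?n. \<gamma>) < v (rf_const (Polynomial.coeff (f - g) i) * rf_const (b ^ i))"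
          by simp
      qed
      finally show ?thesis using f(2) by simp
    qed
    hence "\<exists>\<beta>. poly g \<beta> = 0 \<and> Fin \<gamma> \<le> (v \<circ> rf_const) (b - \<beta>)"
      using lc deg_eq alg_closed_imp_poly_has_root
      by (intro U.root_near) auto
    with deg_eq show "Polynomial.degree g = ?n" "\<exists>\<beta>. poly g \<beta> = 0 \<and> Fin \<gamma> \<le> v (rf_const (b - \<beta>))"
      by (simp_all del: rf_const_simps)
  qed
qed

text \<open>Approximate the minimal polynomial of b over \<open>Kh\<close> by one of the same degree
  over K and take its root near b. The degree bound is what later compares degrees over K and
  \<open>Kh\<close>.\<close>

lemma algebraic_approx:
  assumes \<gamma>: "bdd \<gamma>"
  obtains \<beta> where "\<beta> \<in> algebraic_closure_of K" "Fin \<gamma> \<le> v (rf_const (b - \<beta>))"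
    "simple_ext_degree K \<beta> \<le> simple_ext_degree Kh b"
proof -
  obtain f where f: "poly_over Kh f" "Polynomial.lead_coeff f = 1" "poly f b = 0"
    "Polynomial.degree f = simple_ext_degree Kh b" "0 < Polynomial.degree f"
    using minimal_polynomial_exists[OF Kh, of b] Kh_alg by auto
  obtain N where N: "\<forall>i. bdd (N i)"
    "\<forall>g. Polynomial.degree g \<le> Polynomial.degree f \<longrightarrow>
       (\<forall>i\<le>Polynomial.degree f.
          Fin (N i) < v (rf_const (Polynomial.coeff f i - Polynomial.coeff g i))) \<longrightarrow>
       Polynomial.degree g = Polynomial.degree f \<and>
       (\<exists>\<beta>. poly g \<beta> = 0 \<and> Fin \<gamma> \<le> v (rf_const (b - \<beta>)))"
    using root_continuity[OF f(2,3) \<gamma>] by blast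
  obtain g where g: "poly_over K g" "Polynomial.degree g \<le> Polynomial.degree f"
    "\<And>i. Fin (N i) < v (rf_const (Polynomial.coeff f i - Polynomial.coeff g i))"
    by (rule poly_approx[OF f(1), of N]) (use N(1) in blast)+
  from N(2) g(2,3) obtain \<beta> where
    \<beta>: "Polynomial.degree g = Polynomial.degree f" "poly g \<beta> = 0" "Fin \<gamma> \<le> v (rf_const (b - \<beta>))"
    by blast
  have g0: "g \<noteq> 0" using \<beta>(1) f(5) by auto
  have alg: "\<beta> \<in> algebraic_closure_of K"
    using algebraic_closure_of_iff[OF K] g g0 \<beta> by blast
  have "simple_ext_degree K \<beta> \<le> simple_ext_degree Kh b"
    using simple_ext_degree_le_degree[OF K alg g0 g(1) \<beta>(2)] \<beta>(1) f(4) by simp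
  with alg \<beta>(3) that show ?thesis by blast
qed

end


section \<open>Minimal pairs of definition\<close>

context dense_valued_fields
begin

lemma finite_bdd:
  assumes "finite B" "bdd \<gamma>"
  shows "\<exists>\<mu>. bdd \<mu> \<and> \<gamma> \<le> \<mu> \<and> (\<forall>b\<in>B. b \<noteq> 0 \<longrightarrow> v (rf_const b) \<le> Fin \<mu>)"
  using assms(1)
proof (induction B)
  case empty
  thus ?case using assms(2) by auto
next
  case (insert b B)
  then obtain \<mu> where \<mu>: "bdd \<mu>" "\<gamma> \<le> \<mu>" "\<And>b. b \<in> B \<Longrightarrow> b \<noteq> 0 \<Longrightarrow> v (rf_const b) \<le> Fin \<mu>" by auto
  show ?case
  proof (cases "b = 0")
    case True
    with \<mu> show ?thesis by auto
  next
    case False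
    hence "rf_const b \<noteq> 0" by simp
    then obtain \<beta> where \<beta>: "v (rf_const b) = Fin \<beta>" by (rule v_finite)
    have "v (rf_const c) \<le> Fin (max \<mu> \<beta>)" if "c \<in> insert b B" "c \<noteq> 0" for c
      using that \<mu>(3)[of c] \<beta> by (auto intro: order_trans[of _ "Fin \<mu>"])
    moreover have "bdd (max \<mu> \<beta>)" using \<mu>(1) bdd_const[OF \<beta>] by (rule bdd_max)
    ultimately show ?thesis using \<mu>(2) by (intro exI[of _ "max \<mu> \<beta>"]) (auto simp: le_max_iff_disj)
  qed
qed

text \<open>A finite set is avoided through values: an element whose value exceeds those of all
  nonzero members of B is not in B.\<close>

lemma small_element:
  assumes "value_group v (rf_const ` Kh) \<noteq> {0}" "finite B" "bdd \<gamma>"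
  obtains \<epsilon> where "\<epsilon> \<in> K" "\<epsilon> \<noteq> 0" "\<epsilon> \<notin> B" "Fin \<gamma> < v (rf_const \<epsilon>)"
proof -
  obtain \<mu> where \<mu>: "bdd \<mu>" "\<gamma> \<le> \<mu>" "\<And>b. b \<in> B \<Longrightarrow> b \<noteq> 0 \<Longrightarrow> v (rf_const b) \<le> Fin \<mu>"
    using finite_bdd[OF assms(2,3)] by auto
  obtain \<delta> where \<delta>: "\<delta> \<in> value_group v (rf_const ` Kh)" "\<mu> \<le> \<delta>" using \<mu>(1) by (auto simp: bdd_def)
  obtain \<tau> where \<tau>: "\<tau> \<in> value_group v (rf_const ` Kh)" "\<tau> \<noteq> 0"
    using assms(1) value_group_Kh_closed(1) by blast
  \<comment> \<open>A positive value, present by nontriviality, makes the bound strict: \<delta>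
    itself may equal \<mu>.\<close>
  obtain \<sigma> where \<sigma>: "\<sigma> \<in> value_group v (rf_const ` Kh)" "0 < \<sigma>"
    using \<tau> value_group_Kh_closed(3)[OF \<tau>(1)] neg_0_less_iff_less[of \<tau>] linorder_neqE[of \<tau> 0] by blast
  hence "\<delta> + \<sigma> \<in> value_group v (rf_const ` K)"
    unfolding immediate_const using \<delta>(1) value_group_Kh_closed(2) by blast
  then obtain \<epsilon> where \<epsilon>: "\<epsilon> \<in> K" "v (rf_const \<epsilon>) = Fin (\<delta> + \<sigma>)" by (auto simp: value_group_def)
  have "\<mu> < \<delta> + \<sigma>" using \<delta>(2) \<sigma>(2) by (simp add: add_strict_increasing2 le_less_trans)
  hence less: "Fin \<mu> < v (rf_const \<epsilon>)" using \<epsilon>(2) by simp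
  show ?thesis
  proof
    show "\<epsilon> \<in> K" by fact
    show nz: "\<epsilon> \<noteq> 0" using \<epsilon>(2) by auto
    show "\<epsilon> \<notin> B" using \<mu>(3)[of \<epsilon>] nz less by auto
    show "Fin \<gamma> < v (rf_const \<epsilon>)" using less \<mu>(2) by (auto intro: le_less_trans[of _ "Fin \<mu>"])
  qed
qed

text \<open>
  A common root \<open>x\<close> of \<open>g + \<epsilon>X\<close> and its derivative satisfies \<open>g x = x * g' x\<close> and
  \<open>\<epsilon> = - g' x\<close>; if \<open>g 0 \<noteq> 0\<close> this excludes only finitely many \<open>\<epsilon>\<close>.
\<close>

lemma separable_perturbation:
  fixes g :: "'c poly"
  assumes "poly g 0 \<noteq> 0"
  obtains B where "finite B" "\<And>\<epsilon> x. \<epsilon> \<notin> B \<Longrightarrow> \<not> [:- x, 1:] ^ 2 dvd g + [:0, \<epsilon>:]"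
proof
  \<comment> \<open>At a double root x one has g(x) = x g'(x), so x is a root of this polynomial; it
    is nonzero since its value at 0 is g(0).\<close>
  let ?h = "g - [:0, 1:] * pderiv g"
  have "poly ?h 0 \<noteq> 0" using assms by simp
  hence "?h \<noteq> 0" by (metis poly_0)
  thus "finite ((\<lambda>x. - poly (pderiv g) x) ` {x. poly ?h x = 0})"
    by (intro finite_imageI poly_roots_finite)
  fix \<epsilon> x assume \<epsilon>: "\<epsilon> \<notin> (\<lambda>x. - poly (pderiv g) x) ` {x. poly ?h x = 0}"
  show "\<not> [:- x, 1:] ^ 2 dvd g + [:0, \<epsilon>:]"
  proof
    assume "[:- x, 1:] ^ 2 dvd g + [:0, \<epsilon>:]"
    then obtain q where q: "g + [:0, \<epsilon>:] = [:- x, 1:] ^ 2 * q" by (rule dvdE)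
    have "poly (g + [:0, \<epsilon>:]) x = 0" unfolding q by simp
    hence 1: "poly g x = - (x * \<epsilon>)" by (simp add: eq_neg_iff_add_eq_0)
    have "pderiv (g + [:0, \<epsilon>:]) = pderiv ([:- x, 1:] * ([:- x, 1:] * q))"
      unfolding q by (simp only: power2_eq_square mult.assoc)
    also have "poly \<dots> x = 0" by (simp only: pderiv_mult poly_add poly_mult) simp
    finally have "poly (pderiv g) x + \<epsilon> = 0" by (simp add: pderiv_add pderiv_pCons)
    hence "\<epsilon> = - poly (pderiv g) x" by (simp add: eq_neg_iff_add_eq_0 add.commute)
    moreover from this 1 have "poly ?h x = 0" by simp
    ultimately show False using \<epsilon> by blast
  qed
qed

text \<open>Two small changes of the minimal polynomial: a constant makes its value at 0 nonzero,
  then a linear term \<epsilon> X removes double roots. The linear term works in every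
  characteristic, as its derivative is \<epsilon>.\<close>

lemma separable_approx:
  assumes nontrivial: "value_group v (rf_const ` Kh) \<noteq> {0}"
    and b: "b \<in> algebraic_closure_of K" and \<gamma>: "bdd \<gamma>"
  obtains \<beta> where "\<beta> \<in> separable_closure_of K" "Fin \<gamma> \<le> v (rf_const (b - \<beta>))"
    "simple_ext_degree K \<beta> \<le> simple_ext_degree K b"
proof -
  obtain f where f: "poly_over K f" "Polynomial.lead_coeff f = 1" "poly f b = 0"
    "Polynomial.degree f = simple_ext_degree K b" "0 < Polynomial.degree f"
    by (rule minimal_polynomial_exists[OF K b])
  have deg: "Polynomial.degree f \<ge> 1" using f(5) by simp
  obtain N where N: "\<forall>i. bdd (N i)"
    "\<forall>g. Polynomial.degree g \<le> Polynomial.degree f \<longrightarrow>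
       (\<forall>i\<le>Polynomial.degree f.
          Fin (N i) < v (rf_const (Polynomial.coeff f i - Polynomial.coeff g i))) \<longrightarrow>
       Polynomial.degree g = Polynomial.degree f \<and>
       (\<exists>\<beta>. poly g \<beta> = 0 \<and> Fin \<gamma> \<le> v (rf_const (b - \<beta>)))"
    using root_continuity[OF f(2,3) \<gamma>] by blast
  obtain \<epsilon>0 where \<epsilon>0: "\<epsilon>0 \<in> K" "\<epsilon>0 \<notin> {- poly f 0}" "Fin (N 0) < v (rf_const \<epsilon>0)"
    using small_element[OF nontrivial, of "{- poly f 0}" "N 0"] N(1) by blast
  define g0 where "g0 = f + [:\<epsilon>0:]"
  have "poly g0 0 \<noteq> 0" using \<epsilon>0(2) by (auto simp: g0_def eq_neg_iff_add_eq_0 add.commute)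
  then obtain B where B: "finite B" "\<And>\<epsilon> x. \<epsilon> \<notin> B \<Longrightarrow> \<not> [:- x, 1:] ^ 2 dvd g0 + [:0, \<epsilon>:]"
    by (rule separable_perturbation) blast
  obtain \<epsilon> where \<epsilon>: "\<epsilon> \<in> K" "\<epsilon> \<notin> B" "Fin (N 1) < v (rf_const \<epsilon>)"
    using small_element[OF nontrivial B(1), of "N 1"] N(1) by blast
  define g where "g = g0 + [:0, \<epsilon>:]"
  have g: "poly_over K g"
    unfolding g_def g0_def
    by (intro poly_over_add[OF K] f(1) poly_over_pCons[OF K] poly_over_const[OF K] subfield_zero[OF K] \<epsilon> \<epsilon>0)
  have coeff: "Polynomial.coeff f i - Polynomial.coeff g i = (if i = 0 then - \<epsilon>0 else if i = 1 then - \<epsilon> else 0)" for i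
    by (auto simp: g_def g0_def coeff_pCons split: nat.splits)
  \<comment> \<open>Positive degree of f leaves room for the linear term; for degree 1 it changes
    the leading coefficient, which the precision in N permits.\<close>
  have "Polynomial.degree g \<le> Polynomial.degree f"
    unfolding g_def g0_def using deg by (intro degree_add_le) auto
  moreover have "Fin (N i) < v (rf_const (Polynomial.coeff f i - Polynomial.coeff g i))" for i
    unfolding coeff using \<epsilon>0(3) \<epsilon>(3) by auto
  ultimately obtain \<beta> where \<beta>: "Polynomial.degree g = Polynomial.degree f" "poly g \<beta> = 0"
    "Fin \<gamma> \<le> v (rf_const (b - \<beta>))" using N(2) by blast
  have g0: "g \<noteq> 0" using \<beta>(1) deg by auto
  have alg: "\<beta> \<in> algebraic_closure_of K"
    using algebraic_closure_of_iff[OF K] g g0 \<beta> by blast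
  have "simple_ext_degree K \<beta> \<le> simple_ext_degree K b"
    using simple_ext_degree_le_degree[OF K alg g0 g \<beta>(2)] \<beta>(1) f(4) by simp
  moreover have "\<beta> \<in> separable_closure_of K"
    using B(2)[OF \<epsilon>(2)] by (intro separable_closure_ofI[OF K g0 g \<beta>(2)]) (simp add: g_def)
  ultimately show ?thesis using \<beta>(3) that by blast
qed

end

section \<open>Pairs of definition as maxima of v(X - a)\<close>

locale dense_valuation_transcendental = dense_valued_fields +
  assumes val_trans: "valuation_transcendental v Kh"
begin

lemma linear_in_ratfun: "a \<in> F \<Longrightarrow> rf_X - rf_const a \<in> ratfun F"
  by (intro subfield_diff[OF subfield_ratfun] rf_X_in_ratfun rf_const_in_ratfun)

lemma exists_max:
  obtains a \<gamma> where "v (rf_X - rf_const a) = Fin \<gamma>" "\<forall>b. v (rf_X - rf_const b) \<le> Fin \<gamma>"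
proof -
  have "\<exists>a. \<forall>b. v (rf_X - rf_const b) \<le> v (rf_X - rf_const a)"
  proof (rule ccontr)
    assume "\<not> ?thesis"
    then interpret no_max v by unfold_locales (auto simp: not_le)
    show False using not_valuation_transcendental[OF Kh Kh_alg] val_trans by blast
  qed
  then obtain a where a: "\<And>b. v (rf_X - rf_const b) \<le> v (rf_X - rf_const a)" by blast
  obtain \<gamma> where "v (rf_X - rf_const a) = Fin \<gamma>"
    using v_finite[OF rf_X_minus_const_nonzero] by metis
  with a that show ?thesis by metis
qed

text \<open>X - a need not lie in Kh(X), so cofinality is applied to f in its place: v(f) = c + i
  \<gamma> isolates a positive multiple of \<gamma>.\<close>

lemma bdd_max_value:
  assumes \<gamma>: "v (rf_X - rf_const a) = Fin \<gamma>" "\<forall>b. v (rf_X - rf_const b) \<le> Fin \<gamma>"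
  shows "bdd \<gamma>"
proof -
  obtain f where f: "f \<noteq> 0" "poly_over Kh f" "poly f a = 0" by (rule algebraic_Kh)
  let ?q = "f \<circ>\<^sub>p [:a, 1:]"
  have "to_fract f \<noteq> 0" using f(1) by simp
  then obtain \<pi> where \<pi>: "v (to_fract f) = Fin \<pi>" by (rule v_finite)
  have "v = monomial_valuation (v \<circ> rf_const) a \<gamma>"
    using eq_monomial_valuation_iff[OF krull_valuation_axioms] \<gamma> by blast
  hence "Fin \<pi> = U.gauss \<gamma> ?q"
    using U.monomial_valuation_characterization(2)[of a \<gamma> f] \<pi> by metis
  then obtain i where i: "Fin \<pi> = v (rf_const (Polynomial.coeff ?q i)) + Fin (\<Sum>j<i. \<gamma>)"
    using U.gauss_attained[of \<gamma> ?q] by (metis comp_apply)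
  \<comment> \<open>The constant coefficient of the shifted polynomial is f(a) = 0, of value
    \<open>Pinf\<close>, while v(f) is finite.\<close>
  have "i \<noteq> 0"
  proof
    assume "i = 0"
    with i f(3) show False by simp
  qed
  obtain c where c: "v (rf_const (Polynomial.coeff ?q i)) = Fin c"
    using i not_Minf[of "rf_const (Polynomial.coeff ?q i)"]
    by (cases "v (rf_const (Polynomial.coeff ?q i))") auto
  have "bdd (\<pi> + - c)"
    using bdd_ratfun[OF to_fract_in_ratfun[OF Kh f(2)] \<pi>] bdd_uminus_const[OF c] by (rule bdd_add)
  also have "\<pi> + - c = (\<Sum>j<i. \<gamma>)" using i c by simp
  finally show ?thesis by (rule bdd_multiple) (use \<open>i \<noteq> 0\<close> in simp)
qed

lemma le_v_linear:
  assumes "Fin \<gamma> \<le> v (rf_X - rf_const a)" "Fin \<gamma> \<le> v (rf_const (a - b))"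
  shows "Fin \<gamma> \<le> v (rf_X - rf_const b)"
  using le_v_add[OF assms] by simp

text \<open>The definition bounds v(X - b) only for b algebraic over K. For any other b it suffices
  to find \<beta> algebraic over K with v(b - \<beta>) \<ge> v(X - b), for then v(X - \<beta>) is at
  least as large.\<close>

lemma pair_of_definition_iff:
  "pair_of_definition v K a \<gamma> \<longleftrightarrow> a \<in> algebraic_closure_of K \<and> v (rf_X - rf_const a) = Fin \<gamma> \<and>
     (\<forall>b. v (rf_X - rf_const b) \<le> Fin \<gamma>)"
proof
  assume pair: "pair_of_definition v K a \<gamma>"
  hence a: "a \<in> algebraic_closure_of K"
    and eq: "\<And>f. f \<in> ratfun (algebraic_closure_of K) \<Longrightarrow> v f = monomial_valuation (v \<circ> rf_const) a \<gamma> f"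
    by (auto simp: pair_of_definition_def)
  have lin: "v (rf_X - rf_const b) = min (v (rf_const (a - b))) (Fin \<gamma>)"
    if "b \<in> algebraic_closure_of K" for b
    using eq[OF linear_in_ratfun[OF that]] U.monomial_valuation_linear[of a \<gamma> b] by simp
  have "v (rf_X - rf_const b) \<le> Fin \<gamma>" for b
  proof (rule ccontr)
    assume less: "\<not> ?thesis"
    \<comment> \<open>The true maximum is bounded by a value of \<open>Kh\<close>, hence so is
      \<delta>, as the approximation of b requires.\<close>
    obtain a0 \<gamma>0 where \<gamma>0: "v (rf_X - rf_const a0) = Fin \<gamma>0" "\<forall>b. v (rf_X - rf_const b) \<le> Fin \<gamma>0"
      by (rule exists_max)
    obtain \<delta> where \<delta>: "v (rf_X - rf_const b) = Fin \<delta>"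
      using v_finite[OF rf_X_minus_const_nonzero] by metis
    have "\<delta> \<le> \<gamma>0" using spec[OF \<gamma>0(2), of b] \<delta> by simp
    with bdd_max_value[OF \<gamma>0] have "bdd \<delta>" by (rule bdd_mono)
    then obtain \<beta> where \<beta>: "\<beta> \<in> algebraic_closure_of K" "Fin \<delta> \<le> v (rf_const (b - \<beta>))"
      using algebraic_approx[of \<delta> b] by metis
    have "Fin \<delta> \<le> v (rf_X - rf_const \<beta>)" using \<delta> by (intro le_v_linear[OF _ \<beta>(2)]) simp
    also have "\<dots> \<le> Fin \<gamma>" by (simp only: lin[OF \<beta>(1)] min.cobounded2)
    finally show False using less \<delta> by simp
  qed
  with a lin[OF a] show "a \<in> algebraic_closure_of K \<and> v (rf_X - rf_const a) = Fin \<gamma> \<and>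
     (\<forall>b. v (rf_X - rf_const b) \<le> Fin \<gamma>)" by simp
next
  assume *: "a \<in> algebraic_closure_of K \<and> v (rf_X - rf_const a) = Fin \<gamma> \<and>
     (\<forall>b. v (rf_X - rf_const b) \<le> Fin \<gamma>)"
  hence "v = monomial_valuation (v \<circ> rf_const) a \<gamma>"
    using eq_monomial_valuation_iff[OF krull_valuation_axioms] by blast
  moreover have "\<gamma> \<in> value_group v (ratfun (algebraic_closure_of K))"
    using * linear_in_ratfun[of a "algebraic_closure_of K"] by (auto simp: value_group_def)
  ultimately show "pair_of_definition v K a \<gamma>"
    using * unfolding pair_of_definition_def by simp
qed

text \<open>For b within \<gamma> of a, an approximation \<beta> of b algebraic over K is again
  within \<gamma> of a, so [K(a):K] \<le> [K(\<beta>):K] \<le> [Kh(b):Kh]. The case b = a gives half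
  of the equality of degrees; the minimal polynomial over K, read over \<open>Kh\<close>, gives the
  other half.\<close>

lemma minimal_pair_over_completion:
  assumes "minimal_pair_of_definition v K a \<gamma>"
  shows "minimal_pair_of_definition v Kh a \<gamma>" "simple_ext_degree K a = simple_ext_degree Kh a"
proof -
  have a: "a \<in> algebraic_closure_of K" and \<gamma>: "v (rf_X - rf_const a) = Fin \<gamma>"
    "\<forall>b. v (rf_X - rf_const b) \<le> Fin \<gamma>"
    and min: "\<And>b. b \<in> algebraic_closure_of K \<Longrightarrow> Fin \<gamma> \<le> v (rf_const (a - b)) \<Longrightarrow>
       simple_ext_degree K a \<le> simple_ext_degree K b"
    using assms unfolding minimal_pair_of_definition_def pair_of_definition_iff by blast+
  have le: "simple_ext_degree K a \<le> simple_ext_degree Kh b" if "Fin \<gamma> \<le> v (rf_const (a - b))" for b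
  proof -
    obtain \<beta> where \<beta>: "\<beta> \<in> algebraic_closure_of K" "Fin \<gamma> \<le> v (rf_const (b - \<beta>))"
      "simple_ext_degree K \<beta> \<le> simple_ext_degree Kh b"
      using algebraic_approx[OF bdd_max_value[OF \<gamma>]] by blast
    have "Fin \<gamma> \<le> v (rf_const (a - \<beta>))"
      using le_v_add[OF that \<beta>(2)] by simp
    with min[OF \<beta>(1)] \<beta>(3) show ?thesis by simp
  qed
  have Kh_a: "a \<in> algebraic_closure_of Kh" using Kh_alg by simp
  show eq: "simple_ext_degree K a = simple_ext_degree Kh a"
  proof (rule antisym)
    show "simple_ext_degree K a \<le> simple_ext_degree Kh a" by (rule le) simp
    obtain f where f: "poly_over K f" "Polynomial.lead_coeff f = 1" "poly f a = 0"
      "Polynomial.degree f = simple_ext_degree K a" "0 < Polynomial.degree f"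
      by (rule minimal_polynomial_exists[OF K a])
    have "f \<noteq> 0" using f(2) by auto
    from simple_ext_degree_le_degree[OF Kh Kh_a this poly_over_mono[OF K_sub f(1)] f(3)] f(4)
    show "simple_ext_degree Kh a \<le> simple_ext_degree K a" by simp
  qed
  have "v = monomial_valuation (v \<circ> rf_const) a \<gamma>"
    using eq_monomial_valuation_iff[OF krull_valuation_axioms] \<gamma> by blast
  moreover have "\<gamma> \<in> value_group v (ratfun UNIV)"
    using \<gamma>(1) linear_in_ratfun[of a UNIV] by (auto simp: value_group_def)
  ultimately have "pair_of_definition v Kh a \<gamma>"
    unfolding pair_of_definition_def Kh_alg by simp
  with le eq show "minimal_pair_of_definition v Kh a \<gamma>"
    unfolding minimal_pair_of_definition_def by auto
qed

lemma separable_minimal_pair_exists: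
  obtains a \<gamma> where "minimal_pair_of_definition v K a \<gamma>" "a \<in> separable_closure_of K"
proof -
  obtain a0 \<gamma> where \<gamma>: "v (rf_X - rf_const a0) = Fin \<gamma>" "\<forall>b. v (rf_X - rf_const b) \<le> Fin \<gamma>"
    by (rule exists_max)
  note bdd_\<gamma> = bdd_max_value[OF \<gamma>]
  have "\<exists>a. a \<in> separable_closure_of K \<and> Fin \<gamma> \<le> v (rf_X - rf_const a) \<and>
      (\<forall>b\<in>algebraic_closure_of K. Fin \<gamma> \<le> v (rf_X - rf_const b) \<longrightarrow>
        simple_ext_degree K a \<le> simple_ext_degree K b)"
  proof (cases "value_group v (rf_const ` Kh) = {0}")
    case True
    \<comment> \<open>Trivially valued \<open>Kh\<close> admits no small perturbation. Here
      \<open>bdd\<close> means \<le> 0, so \<gamma> \<le> 0 and, by cofinality applied to 1 / X,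
      also v(X) \<ge> 0. Thus a = 0 attains the maximum, with the least possible degree.\<close>
    hence bdd_iff: "bdd \<delta> \<longleftrightarrow> \<delta> \<le> 0" for \<delta> by (simp add: bdd_def)
    have "rf_X \<noteq> (0 :: 'a poly fract)" using rf_X_minus_const_nonzero[of 0] by simp
    then obtain \<xi> where \<xi>: "v rf_X = Fin \<xi>" by (rule v_finite)
    have "bdd (- \<xi>)"
      by (rule bdd_ratfun[OF subfield_inverse[OF subfield_ratfun rf_X_in_ratfun] v_inverse[OF \<xi>]])
    hence ge: "Fin \<gamma> \<le> v (rf_X - rf_const 0)" using bdd_\<gamma> \<xi> by (simp add: bdd_iff)
    have X: "poly_over K [:0, 1:]" "[:0, 1:] \<noteq> (0 :: 'a poly)" "poly [:0, 1:] 0 = (0 :: 'a)"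
      by (auto intro!: poly_over_pCons[OF K] poly_over_const[OF K] subfield_zero[OF K] subfield_one[OF K])
    have "\<not> [:- x, 1:] ^ 2 dvd [:0, 1 :: 'a:]" for x
      by (auto simp: degree_power_eq dest!: dvd_imp_degree_le)
    hence sep: "0 \<in> separable_closure_of K" by (intro separable_closure_ofI[OF K X(2,1,3)])
    hence alg: "0 \<in> algebraic_closure_of K" by (simp add: separable_closure_of_def)
    have "simple_ext_degree K 0 \<le> simple_ext_degree K b" if b: "b \<in> algebraic_closure_of K" for b
    proof -
      obtain f where f: "poly_over K f" "Polynomial.lead_coeff f = 1" "poly f b = 0"
        "Polynomial.degree f = simple_ext_degree K b" "0 < Polynomial.degree f"
        by (rule minimal_polynomial_exists[OF K b])
      thus ?thesis using simple_ext_degree_le_degree[OF K alg X(2,1,3)] f(4,5) by simp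
    qed
    with sep ge show ?thesis by blast
  next
    case False
    let ?P = "\<lambda>b. b \<in> algebraic_closure_of K \<and> Fin \<gamma> \<le> v (rf_X - rf_const b)"
    obtain \<beta>0 where \<beta>0: "\<beta>0 \<in> algebraic_closure_of K" "Fin \<gamma> \<le> v (rf_const (a0 - \<beta>0))"
      using algebraic_approx[OF bdd_\<gamma>] by blast
    have "?P \<beta>0" using \<beta>0(1) \<gamma>(1) le_v_linear[OF _ \<beta>0(2)] by simp
    \<comment> \<open>First the degree is minimized among all algebraic centres; moving such a
      centre into the separable closure does not raise it.\<close>
    then obtain b where b: "?P b" "\<And>b'. ?P b' \<Longrightarrow> simple_ext_degree K b \<le> simple_ext_degree K b'"
      using ex_has_least_nat[of ?P \<beta>0 "simple_ext_degree K"] by blast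
    obtain a where a: "a \<in> separable_closure_of K" "Fin \<gamma> \<le> v (rf_const (b - a))"
      "simple_ext_degree K a \<le> simple_ext_degree K b"
      using separable_approx[OF False _ bdd_\<gamma>, of b] b(1) by blast
    have "Fin \<gamma> \<le> v (rf_X - rf_const a)" using le_v_linear[OF _ a(2)] b(1) by blast
    moreover have "simple_ext_degree K a \<le> simple_ext_degree K b'" if "?P b'" for b'
      using a(3) b(2)[OF that] by (rule order_trans)
    ultimately show ?thesis using a(1) by blast
  qed
  then obtain a where a: "a \<in> separable_closure_of K" "Fin \<gamma> \<le> v (rf_X - rf_const a)"
    "\<And>b. b \<in> algebraic_closure_of K \<Longrightarrow> Fin \<gamma> \<le> v (rf_X - rf_const b) \<Longrightarrow>
        simple_ext_degree K a \<le> simple_ext_degree K b" by blast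
  have alg: "a \<in> algebraic_closure_of K" using a(1) by (simp add: separable_closure_of_def)
  have "v (rf_X - rf_const a) = Fin \<gamma>" using a(2) \<gamma>(2) by (simp add: antisym)
  hence "pair_of_definition v K a \<gamma>" using alg \<gamma>(2) by (simp add: pair_of_definition_iff)
  \<comment> \<open>Closeness of b to a gives v(X - b) \<ge> \<gamma>, the condition under which the
    degree was minimized.\<close>
  moreover have "simple_ext_degree K a \<le> simple_ext_degree K b"
    if "b \<in> algebraic_closure_of K" "Fin \<gamma> \<le> v (rf_const (a - b))" for b
    using a(3)[OF that(1) le_v_linear[OF a(2) that(2)]] .
  ultimately have "minimal_pair_of_definition v K a \<gamma>"
    unfolding minimal_pair_of_definition_def by blast
  with a(1) that show ?thesis by blast
qed

end

lemma algebraic_closure_UNIV: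
  assumes "algebraic_closure (type_field :: 'c::field ring) F"
  shows "subfield F (type_field :: 'c ring)" "algebraic_closure_of F = UNIV"
proof -
  interpret algebraic_closure "type_field :: 'c ring" F by fact
  show "subfield F (type_field :: 'c ring)" by (rule subfield_axioms)
  show "algebraic_closure_of F = UNIV"
    using algebraic_extension by (auto simp: algebraic_closure_of_def over_def)
qed

theorem proposition3p3:
  fixes v :: "'c::alg_closed_field poly fract \<Rightarrow> 'g::linordered_ab_group_add extended"
    and K Khat :: "'c set"
  assumes "algebraic_closure (type_field :: 'c ring) Khat"
    and "subfield K (type_field :: 'c ring)"
    and "valuation type_field v"
    and "is_completion type_field (v \<circ> rf_const) K Khat"
    and "valuation_transcendental v Khat"
    and cofinal: "\<forall>\<gamma>\<in>value_group v (ratfun Khat). \<exists>\<delta>\<in>value_group v (rf_const ` Khat). \<gamma> \<le> \<delta>"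
  shows "valuation_transcendental v K \<and> induced_by v Khat K \<and>
    (\<exists>a \<gamma>. minimal_pair_of_definition v K a \<gamma> \<and> a \<in> separable_closure_of K) \<and>
    (\<forall>a \<gamma>. minimal_pair_of_definition v K a \<gamma> \<and> a \<in> separable_closure_of K \<longrightarrow>
       minimal_pair_of_definition v Khat a \<gamma> \<and>
       simple_ext_degree K a = simple_ext_degree Khat a) \<and>
    immediate_extension type_field v (ratfun Khat) (ratfun K)"
proof -
  interpret krull_valuation v using assms(3) by (simp add: valuation_type_field_iff)
  have dense: "K \<subseteq> Khat" "dense_subfield type_field (v \<circ> rf_const) K Khat"
    using assms(4) unfolding is_completion_def by blast+
  interpret dense_valuation_transcendental v K Khat
  proof (intro dense_valuation_transcendental.intro dense_valued_fields.intro
      dense_valued_fields_axioms.intro dense_valuation_transcendental_axioms.intro)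
    show "krull_valuation v" by (rule krull_valuation_axioms)
    show "subfield K type_field" "K \<subseteq> Khat" "valuation_transcendental v Khat" by fact+
    show "subfield Khat type_field" "algebraic_closure_of Khat = UNIV"
      using algebraic_closure_UNIV[OF assms(1)] by simp_all
    show "\<exists>b\<in>K. Fin \<gamma> < v (rf_const (a - b))" if "a \<in> Khat" "\<gamma> \<in> value_group v (rf_const ` Khat)" for a \<gamma>
    proof -
      have "\<gamma> \<in> value_group (v \<circ> rf_const) Khat" using that(2) by (auto simp: value_group_def)
      with dense(2) that(1) show ?thesis by (auto simp: dense_subfield_def)
    qed
    show "\<exists>\<delta>\<in>value_group v (rf_const ` Khat). \<gamma> \<le> \<delta>" if "\<gamma> \<in> value_group v (ratfun Khat)" for \<gamma>
      using cofinal that by blast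
  qed
  have trans: "valuation_transcendental v K"
    using val_trans by (simp add: valuation_transcendental_iff)
  obtain a \<gamma> where pair: "minimal_pair_of_definition v K a \<gamma>" "a \<in> separable_closure_of K"
    by (rule separable_minimal_pair_exists)
  hence pod: "pair_of_definition v K a \<gamma>" by (simp add: minimal_pair_of_definition_def)
  \<comment> \<open>The valuations agree on rational functions over all constants, so on Khat(X)
    they are equal and not just equivalent.\<close>
  hence "v = monomial_valuation (v \<circ> rf_const) a \<gamma>"
    using eq_monomial_valuation_iff[OF krull_valuation_axioms] by (simp add: pair_of_definition_iff)
  hence "equivalent_valuations_on (ratfun Khat) v (monomial_valuation (v \<circ> rf_const) a \<gamma>)"
    by (simp add: equivalent_valuations_on_def)
  with trans pod have "induced_by v Khat K" unfolding induced_by_def by blast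
  moreover have "immediate_extension type_field v (ratfun Khat) (ratfun K)"
    by (simp add: immediate_extension_def immediate_ratfun)
  ultimately show ?thesis
    using trans pair minimal_pair_over_completion by blast
qed

end
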